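(* Let $\alpha,\beta>-1$, $n\ge1$, let $x_{k,n}=\cos\theta_{k,n}$, $1\le k\le n$, be the zeros of the Jacobi polynomial $P_n^{(\alpha,\beta)}$, and let $s_{j,k}=\cos\frac{\theta_{j,n}-\theta_{k,n}}2$, $t_{j,k}=\cos\frac{\theta_{j,n}+\theta_{k,n}}2$. Set $$\mathbf{x}^{(1)}_{j,k}=(s_{j,k},t_{j,k}),\quad \mathbf{x}^{(2)}_{j,k}=(t_{j,k},s_{j,k}),\quad \mathbf{x}^{(3)}_{j,k}=(-s_{j,k},-t_{j,k}),\quad \mathbf{x}^{(4)}_{j,k}=(-t_{j,k},-s_{j,k}).$$ Then the Lagrange interpolation polynomial $\mathcal{L}_n^{\alpha,\beta}f$, i.e. the unique element of $\Pi_{2n}^*$ that agrees with $f$ at all points $\mathbf{x}^{(i)}_{j,k}$, $1\le j\le k\le n$, $1\le i\le4$, is given by $$\mathcal{L}_n^{\alpha,\beta}f(x,y)=\sum_{k=1}^n\sum_{j=1}^k\sum_{i=1}^4 f\big(\mathbf{x}^{(i)}_{j,k}\big)\,\ell^{(i)}_{j,k}(x,y),$$ where $$\ell^{(i)}_{j,k}(x,y)=\tfrac12\lambda_j^{(\alpha,\beta)}\lambda_k^{(\alpha,\beta)}\,\mathcal{K}_{2n}^*\big((x,y),\mathbf{x}^{(i)}_{j,k}\big),$$ with $\frac12$ replaced by $\frac14$ when $j=k$, and, for $x=(x_1,x_2)$, $y=(y_1,y_2)$, $$\begin{aligned}\mathcal{K}_{2n}^*(x,y)=\ &\mathcal{K}_{2n-1}^{\alpha,\beta}(x,y)\\&+\frac{1+\alpha+\beta+n}{1+\alpha+\beta+2n}\,d^{(1,1)}_{\alpha,\beta}(x_1^2-x_2^2)(y_1^2-y_2^2)\left[K_{n-1}^{\alpha+1,\beta+1}(s,t)-K_{n-2}^{\alpha+1,\beta+1}(s,t)\right]\\&-\frac{n(1+\alpha+\beta+n)}{(1+\alpha+\beta+2n)^2}\,{}_2Q_{n-1,2n}(x)\,{}_2Q_{n-1,2n}(y),\end{aligned}$$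 where $s=(2x_1x_2,x_1^2+x_2^2-1)$ and $t=(2y_1y_2,y_1^2+y_2^2-1)$.
   Context: For $a,b>-1$ let $w_{a,b}(x)=(1-x)^a(1+x)^b$ on $[-1,1]$, $c_{a,b}=\big(\int_{-1}^1w_{a,b}\big)^{-1}$, and let $p_m^{(a,b)}$ be the orthonormal Jacobi polynomials with positive leading coefficients: $c_{a,b}\int_{-1}^1p_m^{(a,b)}p_l^{(a,b)}w_{a,b}\,dx=\delta_{m,l}$. Put $k_m^{(a,b)}(x,y)=\sum_{i=0}^mp_i^{(a,b)}(x)p_i^{(a,b)}(y)$ and $k_{-1}^{(a,b)}=0$. The numbers $\lambda_k^{(\alpha,\beta)}=[k_n^{(\alpha,\beta)}(x_{k,n},x_{k,n})]^{-1}$ are the Gaussian quadrature weights: $c_{\alpha,\beta}\int_{-1}^1fw_{\alpha,\beta}\,dx=\sum_{k=1}^n\lambda_k^{(\alpha,\beta)}f(x_{k,n})$ for polynomials $f$ of degree $\le2n-1$. Angles satisfy $0<\theta_{k,n}<\pi$. The points $\mathbf{x}_{j,k}^{(i)}$ are the nodes of the minimal cubature rule of degree $4n-1$ for the weight $$\mathcal{W}_{\alpha,\beta}(x_1,x_2)=c_{\alpha,\beta}^2\frac{|x_1-x_2|^{2\alpha+1}|x_1+x_2|^{2\beta+1}}{\sqrt{1-x_1^2}\sqrt{1-x_2^2}}\quad\text{on }[-1,1]^2 .$$ For $x=(x_1,x_2)=(\cos\theta,\cos\phi)$ and $0\le k\le n-2$ define $${}_2Q_{k,2n}(x)=\gamma_{\alpha,\beta}(x_1^2-x_2^2)\left[p_{n-1}^{(\alpha+1,\beta+1)}(\cos(\theta-\phi))\,p_k^{(\alpha+1,\beta+1)}(\cos(\theta+\phi))+p_k^{(\alpha+1,\beta+1)}(\cos(\theta-\phi))\,p_{n-1}^{(\alpha+1,\beta+1)}(\cos(\theta+\phi))\right],$$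 with $\gamma_{\alpha,\beta}=c_{\alpha+1,\beta+1}/(\sqrt2\,c_{\alpha,\beta})$; for $k=n-1$ the same expression is multiplied by $\sqrt2/2$. These are polynomials in $(x_1,x_2)$ of degree $2n$, orthonormal with respect to $\mathcal{W}_{\alpha,\beta}$ and orthogonal to all polynomials of lower degree. $\Pi_m^2$ is the space of polynomials in two variables of total degree $\le m$, and $\Pi_{2n}^*=\Pi_{2n-1}^2+\mathrm{span}\{{}_2Q_{k,2n}:0\le k\le n-1\}$. Let $d_{\alpha,\beta}^{(i,j)}=c_{\alpha+i,\beta+j}^2/c_{\alpha,\beta}^2$. For $a,b>-1$, $(x_1,x_2)=(\cos\theta_1,\cos\theta_2)$, $(y_1,y_2)=(\cos\phi_1,\cos\phi_2)$ and $s,t$ as in the claim, let $$\begin{aligned}K_m^{a,b}(s,t)=\tfrac12\big[&k_m^{(a,b)}(\cos(\theta_1-\theta_2),\cos(\phi_1-\phi_2))\,k_m^{(a,b)}(\cos(\theta_1+\theta_2),\cos(\phi_1+\phi_2))\\+&k_m^{(a,b)}(\cos(\theta_1-\theta_2),\cos(\phi_1+\phi_2))\,k_m^{(a,b)}(\cos(\theta_1+\theta_2),\cos(\phi_1-\phi_2))\big],\end{aligned}$$ and $$\begin{aligned}\mathcal{K}_{2n-1}^{\alpha,\beta}(x,y)=\ &K_{n-1}^{\alpha,\beta}(s,t)+d^{(1,1)}_{\alpha,\beta}(x_1^2-x_2^2)(y_1^2-y_2^2)K_{n-2}^{\alpha+1,\beta+1}(s,t)\\&+d^{(0,1)}_{\alpha,\beta}(x_1+x_2)(y_1+y_2)K_{n-1}^{\alpha,\beta+1}(s,t)+d^{(1,0)}_{\alpha,\beta}(x_1-x_2)(y_1-y_2)K_{n-1}^{\alpha+1,\beta}(s,t),\end{aligned}$$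 which is the reproducing kernel of $\Pi^2_{2n-1}$ in $L^2(\mathcal{W}_{\alpha,\beta})$. All these are polynomials in $(x,y)$, so they extend from $[-1,1]^2\times[-1,1]^2$. *)

theory Defs
  imports "HOL-Analysis.Analysis" "HOL-Computational_Algebra.Polynomial"
begin

definition jacobi_weight :: "real \<Rightarrow> real \<Rightarrow> real \<Rightarrow> real" where
  "jacobi_weight a b x = (1 - x) powr a * (1 + x) powr b"

definition jacobi_c :: "real \<Rightarrow> real \<Rightarrow> real" where
  "jacobi_c a b = inverse (integral {-1..1} (jacobi_weight a b))"

(* The classical Jacobi polynomial, in Szego's normalisation P_n(1) = (n + a) gchoose n:
   P_n(x) = sum_s ((n+a) gchoose (n-s)) ((n+b) gchoose s) ((x-1)/2)^s ((x+1)/2)^(n-s). *)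
definition jacobi_P :: "real \<Rightarrow> real \<Rightarrow> nat \<Rightarrow> real poly" where
  "jacobi_P a b n =
     (\<Sum>s\<le>n. smult (((real n + a) gchoose (n - s)) * ((real n + b) gchoose s))
               ([:-1/2, 1/2:] ^ s * [:1/2, 1/2:] ^ (n - s)))"

definition jacobi_orthonormal :: "real \<Rightarrow> real \<Rightarrow> (nat \<Rightarrow> real poly) \<Rightarrow> bool" where
  "jacobi_orthonormal a b p \<longleftrightarrow>
     (\<forall>m. degree (p m) = m \<and> lead_coeff (p m) > 0) \<and>
     (\<forall>m l. jacobi_c a b *
              integral {-1..1} (\<lambda>x. poly (p m) x * poly (p l) x * jacobi_weight a b x)
            = (if m = l then 1 else 0))"

(* For a, b > -1 exactly one sequence satisfies the predicate. *)
definition jacobi_p :: "real \<Rightarrow> real \<Rightarrow> nat \<Rightarrow> real poly" where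
  "jacobi_p a b = (THE p. jacobi_orthonormal a b p)"

(* The index is an integer so that the value -1 gives the empty sum. *)
definition jacobi_k :: "real \<Rightarrow> real \<Rightarrow> int \<Rightarrow> real \<Rightarrow> real \<Rightarrow> real" where
  "jacobi_k a b m x y = (\<Sum>i<nat (m + 1). poly (jacobi_p a b i) x * poly (jacobi_p a b i) y)"

definition gauss_lambda :: "real \<Rightarrow> real \<Rightarrow> nat \<Rightarrow> real \<Rightarrow> real" where
  "gauss_lambda \<alpha> \<beta> n x = inverse (jacobi_k \<alpha> \<beta> (int n) x x)"

definition cub_node :: "(nat \<Rightarrow> real) \<Rightarrow> nat \<Rightarrow> nat \<Rightarrow> nat \<Rightarrow> real \<times> real" where
  "cub_node \<theta> i j k =
     (let s = cos ((\<theta> j - \<theta> k) / 2); t = cos ((\<theta> j + \<theta> k) / 2)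
      in if i = 1 then (s, t) else if i = 2 then (t, s)
         else if i = 3 then (- s, - t) else (- t, - s))"

(* Bivariate real polynomials are represented by their functions on the plane;
   this is the space of those of total degree at most m. *)
definition Pi2 :: "nat \<Rightarrow> (real \<times> real \<Rightarrow> real) set" where
  "Pi2 m = {P. \<exists>c :: nat \<Rightarrow> nat \<Rightarrow> real.
                 P = (\<lambda>(x, y). \<Sum>i\<le>m. \<Sum>j\<le>m - i. c i j * x ^ i * y ^ j)}"

definition Q_gamma :: "real \<Rightarrow> real \<Rightarrow> real" where
  "Q_gamma \<alpha> \<beta> = jacobi_c (\<alpha> + 1) (\<beta> + 1) / (sqrt 2 * jacobi_c \<alpha> \<beta>)"

(* The polynomial on the whole plane extending the trigonometric expression, which only gives
   values on the square [-1,1]^2. It exists because the expression is symmetric in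
   u = cos (\<theta> - \<phi>), v = cos (\<theta> + \<phi>), and u + v = 2 x1 x2, u v = x1^2 + x2^2 - 1;
   it is unique because the square has interior points. *)
definition Q2 :: "real \<Rightarrow> real \<Rightarrow> nat \<Rightarrow> nat \<Rightarrow> real \<times> real \<Rightarrow> real" where
  "Q2 \<alpha> \<beta> n k =
     (THE P. real_polynomial_function P \<and>
        (\<forall>\<theta> \<phi>. P (cos \<theta>, cos \<phi>) =
           (if k = n - 1 then sqrt 2 / 2 else 1) *
           (Q_gamma \<alpha> \<beta> * ((cos \<theta>)\<^sup>2 - (cos \<phi>)\<^sup>2) *
            (poly (jacobi_p (\<alpha> + 1) (\<beta> + 1) (n - 1)) (cos (\<theta> - \<phi>)) *
             poly (jacobi_p (\<alpha> + 1) (\<beta> + 1) k) (cos (\<theta> + \<phi>)) +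
             poly (jacobi_p (\<alpha> + 1) (\<beta> + 1) k) (cos (\<theta> - \<phi>)) *
             poly (jacobi_p (\<alpha> + 1) (\<beta> + 1) (n - 1)) (cos (\<theta> + \<phi>))))))"

definition Pi_star :: "real \<Rightarrow> real \<Rightarrow> nat \<Rightarrow> (real \<times> real \<Rightarrow> real) set" where
  "Pi_star \<alpha> \<beta> n =
     {\<lambda>x. P x + (\<Sum>k<n. b k * Q2 \<alpha> \<beta> n k x) | P (b :: nat \<Rightarrow> real). P \<in> Pi2 (2 * n - 1)}"

definition jacobi_d :: "real \<Rightarrow> real \<Rightarrow> nat \<Rightarrow> nat \<Rightarrow> real" where
  "jacobi_d \<alpha> \<beta> i j = (jacobi_c (\<alpha> + real i) (\<beta> + real j))\<^sup>2 / (jacobi_c \<alpha> \<beta>)\<^sup>2"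

(* K_m(s,t), with s and t attached to the points x and y, as a polynomial in (x, y) on all of
   R^2 x R^2; existence and uniqueness of the extension are as for Q2. *)
definition K_prod :: "real \<Rightarrow> real \<Rightarrow> int \<Rightarrow> real \<times> real \<Rightarrow> real \<times> real \<Rightarrow> real" where
  "K_prod a b m x y =
     (THE P :: (real \<times> real) \<times> (real \<times> real) \<Rightarrow> real. real_polynomial_function P \<and>
        (\<forall>\<theta>1 \<theta>2 \<phi>1 \<phi>2. P ((cos \<theta>1, cos \<theta>2), (cos \<phi>1, cos \<phi>2)) =
           1/2 * (jacobi_k a b m (cos (\<theta>1 - \<theta>2)) (cos (\<phi>1 - \<phi>2)) *
                  jacobi_k a b m (cos (\<theta>1 + \<theta>2)) (cos (\<phi>1 + \<phi>2)) +
                  jacobi_k a b m (cos (\<theta>1 - \<theta>2)) (cos (\<phi>1 + \<phi>2)) *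
                  jacobi_k a b m (cos (\<theta>1 + \<theta>2)) (cos (\<phi>1 - \<phi>2))))) (x, y)"

definition K_odd :: "real \<Rightarrow> real \<Rightarrow> nat \<Rightarrow> real \<times> real \<Rightarrow> real \<times> real \<Rightarrow> real" where
  "K_odd \<alpha> \<beta> n x y =
     (case x of (x1, x2) \<Rightarrow> case y of (y1, y2) \<Rightarrow>
       K_prod \<alpha> \<beta> (int n - 1) x y
       + jacobi_d \<alpha> \<beta> 1 1 * (x1\<^sup>2 - x2\<^sup>2) * (y1\<^sup>2 - y2\<^sup>2) * K_prod (\<alpha> + 1) (\<beta> + 1) (int n - 2) x y
       + jacobi_d \<alpha> \<beta> 0 1 * (x1 + x2) * (y1 + y2) * K_prod \<alpha> (\<beta> + 1) (int n - 1) x y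
       + jacobi_d \<alpha> \<beta> 1 0 * (x1 - x2) * (y1 - y2) * K_prod (\<alpha> + 1) \<beta> (int n - 1) x y)"

definition K_star :: "real \<Rightarrow> real \<Rightarrow> nat \<Rightarrow> real \<times> real \<Rightarrow> real \<times> real \<Rightarrow> real" where
  "K_star \<alpha> \<beta> n x y =
     (case x of (x1, x2) \<Rightarrow> case y of (y1, y2) \<Rightarrow>
       K_odd \<alpha> \<beta> n x y
       + (1 + \<alpha> + \<beta> + real n) / (1 + \<alpha> + \<beta> + 2 * real n)
         * jacobi_d \<alpha> \<beta> 1 1 * (x1\<^sup>2 - x2\<^sup>2) * (y1\<^sup>2 - y2\<^sup>2)
         * (K_prod (\<alpha> + 1) (\<beta> + 1) (int n - 1) x y - K_prod (\<alpha> + 1) (\<beta> + 1) (int n - 2) x y)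
       - real n * (1 + \<alpha> + \<beta> + real n) / (1 + \<alpha> + \<beta> + 2 * real n)\<^sup>2
         * Q2 \<alpha> \<beta> n (n - 1) x * Q2 \<alpha> \<beta> n (n - 1) y)"

definition interpolates ::
  "nat \<Rightarrow> (nat \<Rightarrow> real) \<Rightarrow> (real \<times> real \<Rightarrow> real) \<Rightarrow> (real \<times> real \<Rightarrow> real) \<Rightarrow> bool" where
  "interpolates n \<theta> f L \<longleftrightarrow>
     (\<forall>k\<in>{1..n}. \<forall>j\<in>{1..k}. \<forall>i\<in>{1..4}. L (cub_node \<theta> i j k) = f (cub_node \<theta> i j k))"

definition lagrange_interp ::
  "real \<Rightarrow> real \<Rightarrow> nat \<Rightarrow> (nat \<Rightarrow> real) \<Rightarrow> (real \<times> real \<Rightarrow> real) \<Rightarrow> real \<times> real \<Rightarrow> real" where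
  "lagrange_interp \<alpha> \<beta> n \<theta> f = (THE L. L \<in> Pi_star \<alpha> \<beta> n \<and> interpolates n \<theta> f L)"

definition lagrange_ell ::
  "real \<Rightarrow> real \<Rightarrow> nat \<Rightarrow> (nat \<Rightarrow> real) \<Rightarrow> nat \<Rightarrow> nat \<Rightarrow> nat \<Rightarrow> real \<times> real \<Rightarrow> real" where
  "lagrange_ell \<alpha> \<beta> n \<theta> i j k x =
     (if j = k then 1/4 else 1/2)
     * gauss_lambda \<alpha> \<beta> n (cos (\<theta> j)) * gauss_lambda \<alpha> \<beta> n (cos (\<theta> k))
     * K_star \<alpha> \<beta> n x (cub_node \<theta> i j k)"

end

theory Submission
  imports Defs
begin

text \<open>
  With \<open>(x\<^sub>1, x\<^sub>2) = (cos \<theta>, cos \<phi>)\<close> put \<open>u = cos (\<theta> - \<phi>)\<close>, \<open>v = cos (\<theta> + \<phi>)\<close>, \<open>s = x\<^sub>1 + x\<^sub>2\<close> and \<open>d = x\<^sub>1 - x\<^sub>2\<close>.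
  Symmetric polynomials in \<open>u\<close> and \<open>v\<close> are polynomials in \<open>(x\<^sub>1, x\<^sub>2)\<close>, and \<open>s\<^sup>2 = (1 + u) (1 + v)\<close>,
  \<open>d\<^sup>2 = (1 - u) (1 - v)\<close>. Hence every plane polynomial is \<open>A + s B + d C + s d E\<close> with symmetric \<open>A, B, C, E\<close>,
  and counting degrees shows that \<open>Pi_star\<close> consists exactly of those for which all four parts have
  degree less than \<open>n\<close> in each of \<open>u\<close> and \<open>v\<close>: the polynomials \<open>Q2\<close> supply the missing top part of \<open>E\<close>
  (\<open>Pi2_subset_sym_hull\<close>, \<open>Pi_star_sum_diff_sym_ext\<close>).

  At the nodes, \<open>(u, v)\<close> runs through the pairs of Jacobi zeros, and the four nodes of a pair carry the
  four sign choices of \<open>s\<close> and \<open>d\<close>. So interpolation in \<open>Pi_star\<close> is a tensor product: with \<open>L\<^sub>k\<close> the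
  univariate Lagrange basis at the zeros, the basis function of a node at which \<open>s = S\<close> and \<open>d = T\<close> is a
  constant multiple of
  \<open>(L\<^sub>k(u) L\<^sub>j(v) + L\<^sub>j(u) L\<^sub>k(v)) (1 + s/S) (1 + d/T)\<close>. From this formula (\<open>lagrange_ell_eq\<close>) follow the
  values at the nodes (\<open>lagrange_ell_cub_node\<close>), membership in \<open>Pi_star\<close>, and the fact that every element
  of \<open>Pi_star\<close> is recovered from its values at the nodes (\<open>reproduced_Pi_star\<close>), which gives existence,
  uniqueness and the explicit form at once.

  It remains to see that the kernel expression equals that product (\<open>K_star_cub_node\<close>). Expanding the
  product gives four terms, and each involves \<open>L\<^sub>k\<close> written as a kernel for the weight multiplied by
  \<open>1\<close>, \<open>1 + x\<close>, \<open>1 - x\<close> or \<open>1 - x\<^sup>2\<close>. For the first three, Gauss quadrature is exact on all products that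
  occur, so the ordinary Jacobi kernel of order \<open>n - 1\<close> appears (\<open>L_kernel\<close>,
  \<open>L_kernel_linear_modification\<close>). For \<open>1 - x\<^sup>2\<close> the square of the top polynomial is just out of reach, and
  its discrete norm is \<open>(1 + \<alpha> + \<beta> + 2n) / (1 + \<alpha> + \<beta> + n)\<close> instead of \<open>1\<close>
  (\<open>quadratic_modification_norm\<close>). Tensoring this defect with itself yields the two correction terms by
  which \<open>K_star\<close> differs from the reproducing kernel of degree \<open>2n - 1\<close>.
\<close>

section \<open>The Jacobi weight and its classical polynomials\<close>

text \<open>The affine substitution \<open>t = (1 - x) / 2\<close> turns the weight into the integrand of the Beta
function, whose integrability is known.\<close>

lemma powr_weight_integrable:
  assumes "a > -1" "b > -1"
  shows "jacobi_weight a b integrable_on {-1..1}"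
proof -
  have "(\<lambda>t. t powr ((a+1) - 1) * (1 - t) powr ((b+1) - 1)) integrable_on {0..1}"
    using has_integral_Beta_real[of "a+1" "b+1"] assms by (auto simp: integrable_on_def)
  then have "(\<lambda>t. t powr a * (1 - t) powr b) integrable_on cbox 0 (1::real)"
    by simp
  from integrable_on_affinity[OF _ this, of "-1/2" "1/2"]
  have "(\<lambda>x. (1/2 - x/2) powr a * (1 - (1/2 - x/2)) powr b) integrable_on ((\<lambda>x. 1 - 2*x) ` {0..1})"
    by (simp add: algebra_simps)
  also have "(\<lambda>x::real. 1 - 2*x) ` {0..1} = {-1..1}"
  proof -
    have "x \<in> (\<lambda>x. 1 - 2*x) ` {0..1}" if "x \<in> {-1..1}" for x :: real
      using that by (intro image_eqI[of _ _ "(1-x)/2"]) (auto simp: field_simps)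
    then show ?thesis by auto
  qed
  finally have "(\<lambda>x. (2 powr a * 2 powr b) * ((1/2 - x/2) powr a * (1 - (1/2 - x/2)) powr b)) integrable_on {-1..1}"
    by (rule integrable_on_mult_right)
  then show ?thesis
  proof (rule integrable_eq)
    fix x :: real assume "x \<in> {-1..1}"
    then have "(2 * (1/2 - x/2)) powr a = 2 powr a * (1/2 - x/2) powr a"
      "(2 * (1/2 + x/2)) powr b = 2 powr b * (1/2 + x/2) powr b"
      by (subst powr_mult; simp)+
    then show "(2 powr a * 2 powr b) * ((1/2 - x/2) powr a * (1 - (1/2 - x/2)) powr b)
        = jacobi_weight a b x"
      by (simp add: jacobi_weight_def algebra_simps)
  qed
qed

lemma jacobi_weight_nonneg: "jacobi_weight a b x \<ge> 0"
  by (simp add: jacobi_weight_def)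

text \<open>For negative exponents the weight is unbounded, so continuity alone does not give integrability;
but a nonnegative integrable weight is absolutely integrable, and the polynomial factor is bounded.\<close>

lemma poly_weight_integrable:
  assumes "a > -1" "b > -1"
  shows "(\<lambda>x. poly p x * jacobi_weight a b x) integrable_on {-1..1}"
proof -
  have "jacobi_weight a b absolutely_integrable_on {-1..1}"
    using powr_weight_integrable[OF assms] jacobi_weight_nonneg
    by (intro nonnegative_absolutely_integrable_1) auto
  then have "(\<lambda>x. poly p x * jacobi_weight a b x) absolutely_integrable_on {-1..1}"
    by (intro absolutely_integrable_bounded_measurable_product_real
        compact_imp_bounded compact_continuous_image
        continuous_imp_measurable_on_sets_lebesgue continuous_intros) auto
  then show ?thesis
    using set_lebesgue_integral_eq_integral(1) by blast
qed

definition jacobi_int :: "real \<Rightarrow> real \<Rightarrow> real poly \<Rightarrow> real" where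
  "jacobi_int a b p = integral {-1..1} (\<lambda>x. poly p x * jacobi_weight a b x)"

context
  fixes a b :: real
  assumes ab: "a > -1" "b > -1"
begin

lemma jacobi_int_add: "jacobi_int a b (p + q) = jacobi_int a b p + jacobi_int a b q"
  using integral_add[OF poly_weight_integrable[OF ab] poly_weight_integrable[OF ab], of p q]
  by (simp add: jacobi_int_def algebra_simps)

lemma jacobi_int_smult: "jacobi_int a b (smult c p) = c * jacobi_int a b p"
  by (simp add: jacobi_int_def algebra_simps flip: integral_mult_right)

lemma jacobi_int_diff: "jacobi_int a b (p - q) = jacobi_int a b p - jacobi_int a b q"
  using jacobi_int_add[of p "smult (-1) q"] jacobi_int_smult[of "-1" q] by simp

lemma jacobi_int_0: "jacobi_int a b 0 = 0"
  by (simp add: jacobi_int_def)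

lemma jacobi_int_sum: "jacobi_int a b (sum f A) = (\<Sum>i\<in>A. jacobi_int a b (f i))"
  by (induction A rule: infinite_finite_induct) (auto simp: jacobi_int_0 jacobi_int_add)

text \<open>The weight may be infinite or zero at the endpoints only. Vanishing of the integral would force
vanishing on the middle interval \<open>[-1/2, 1/2]\<close>, where everything is continuous, and hence infinitely
many zeros of the polynomial.\<close>

lemma jacobi_int_square_pos:
  assumes "p \<noteq> 0"
  shows "jacobi_int a b (p * p) > 0"
proof -
  let ?f = "\<lambda>x. poly (p * p) x * jacobi_weight a b x"
  have nonneg: "?f x \<ge> 0" for x
    by (simp add: jacobi_weight_nonneg)
  have int: "?f integrable_on {-1..1}"
    by (rule poly_weight_integrable[OF ab])
  have cont: "continuous_on {-1/2..1/2} ?f"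
    unfolding jacobi_weight_def by (intro continuous_intros) auto
  have ge: "integral {-1/2..1/2} ?f \<le> integral {-1..1} ?f"
    using int nonneg by (intro integral_subset_le integrable_continuous_real[OF cont]) auto
  have "integral {-1/2..1/2} ?f \<noteq> 0"
  proof
    assume "integral {-1/2..1/2} ?f = 0"
    then have "(?f has_integral 0) (cbox (-1/2) (1/2))"
      using integrable_integral[OF integrable_continuous_real[OF cont]] by simp
    then have "?f x = 0" if "x \<in> cbox (-1/2) (1/2)" for x
      using has_integral_0_cbox_imp_0[of "-1/2" "1/2" ?f x] cont nonneg that by auto
    then have "poly p x = 0" if "x \<in> {-1/2..1/2}" for x
      using that by (fastforce simp: jacobi_weight_def)
    then have "{-1/2..1/2} \<subseteq> {x. poly p x = 0}" by auto
    moreover have "infinite {-1/2..1/2::real}"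
      by simp
    ultimately show False
      using poly_roots_finite[OF assms] finite_subset by blast
  qed
  moreover have "integral {-1/2..1/2} ?f \<ge> 0"
    using nonneg cont by (intro integral_nonneg integrable_continuous_real) auto
  ultimately show ?thesis
    using ge by (simp add: jacobi_int_def)
qed

lemma jacobi_c_pos: "jacobi_c a b > 0"
  using jacobi_int_square_pos[of 1] by (simp add: jacobi_c_def jacobi_int_def)

end

lemma jacobi_int_Suc_left: "jacobi_int (a + 1) b p = jacobi_int a b ([:1, -1:] * p)"
  unfolding jacobi_int_def jacobi_weight_def
  by (rule Henstock_Kurzweil_Integration.integral_cong) (auto simp: powr_add algebra_simps)

lemma jacobi_int_Suc_right: "jacobi_int a (b + 1) p = jacobi_int a b ([:1, 1:] * p)"
  unfolding jacobi_int_def jacobi_weight_def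
  by (rule Henstock_Kurzweil_Integration.integral_cong) (auto simp: powr_add algebra_simps)

lemma jacobi_int_Suc_Suc: "jacobi_int (a + 1) (b + 1) p = jacobi_int a b ([:1, 0, -1:] * p)"
proof -
  have "[:1, 1:] * ([:1, -1:] * p) = [:1, 0, -1:] * p"
    by (simp only: mult.assoc[symmetric]) simp
  then show ?thesis
    by (metis jacobi_int_Suc_left jacobi_int_Suc_right mult.left_commute)
qed

text \<open>The differential expression in \<open>(r w\<^bsub>a+1,b+1\<^esub>)' = (pearson_op a b r) w\<^bsub>a,b\<^esub>\<close>, where \<open>w\<^bsub>a,b\<^esub>\<close> is the
Jacobi weight. It raises the degree by one and lowers both exponents by one.\<close>

definition pearson_op :: "real \<Rightarrow> real \<Rightarrow> real poly \<Rightarrow> real poly" where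
  "pearson_op a b r = [:1, 0, -1:] * pderiv r + [:b - a, -(a + b + 2):] * r"

text \<open>By the fundamental theorem of calculus: the integrand is the derivative of a function that
vanishes at both endpoints because the raised exponents are positive.\<close>

lemma jacobi_int_pearson_op:
  assumes ab: "a > -1" "b > -1"
  shows "jacobi_int a b (pearson_op a b r) = 0"
proof -
  let ?F = "\<lambda>x. poly r x * ((1 - x) powr (a + 1) * (1 + x) powr (b + 1))"
  have "continuous_on {-1..1} ?F"
    using ab by (intro continuous_intros continuous_on_powr') auto
  moreover have "(?F has_vector_derivative poly (pearson_op a b r) x * jacobi_weight a b x) (at x)"
    if "x \<in> {-1<..<1}" for x
  proof -
    have "(?F has_real_derivative
        poly (pderiv r) x * ((1 - x) powr (a + 1) * (1 + x) powr (b + 1)) +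
        poly r x * (- ((a + 1) * (1 - x) powr a) * (1 + x) powr (b + 1)
          + (1 - x) powr (a + 1) * ((b + 1) * (1 + x) powr b))) (at x)"
      using that by (auto intro!: derivative_eq_intros poly_DERIV)
    moreover have powr1: "(1 - x) powr (a + 1) = (1 - x) * (1 - x) powr a"
      "(1 + x) powr (b + 1) = (1 + x) * (1 + x) powr b"
      using that by (auto simp: powr_add)
    have "poly (pderiv r) x * ((1 - x) powr (a + 1) * (1 + x) powr (b + 1)) +
        poly r x * (- ((a + 1) * (1 - x) powr a) * (1 + x) powr (b + 1)
          + (1 - x) powr (a + 1) * ((b + 1) * (1 + x) powr b))
        = poly (pearson_op a b r) x * jacobi_weight a b x"
      unfolding powr1 by (simp add: pearson_op_def jacobi_weight_def algebra_simps)
    ultimately show ?thesis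
      unfolding has_real_derivative_iff_has_vector_derivative[symmetric] by (simp only:)
  qed
  ultimately have "((\<lambda>x. poly (pearson_op a b r) x * jacobi_weight a b x) has_integral ?F 1 - ?F (-1)) {-1..1}"
    by (intro fundamental_theorem_of_calculus_interior) auto
  then show ?thesis
    by (simp add: jacobi_int_def integral_unique)
qed

text \<open>The raising operator \<open>pearson_op\<close> is minus the adjoint of differentiation.\<close>

lemma jacobi_int_by_parts:
  assumes ab: "a > -1" "b > -1"
  shows "jacobi_int a b (pearson_op a b r * q) = - jacobi_int (a + 1) (b + 1) (r * pderiv q)"
proof -
  have "pearson_op a b (r * q) = pearson_op a b r * q + [:1, 0, -1:] * (r * pderiv q)"
    by (simp add: pearson_op_def pderiv_mult ring_distribs mult_ac del: mult_pCons_left mult_pCons_right)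
  then have "0 = jacobi_int a b (pearson_op a b r * q) + jacobi_int (a+1) (b+1) (r * pderiv q)"
    using jacobi_int_pearson_op[OF ab, of "r * q"]
    by (simp add: jacobi_int_add[OF ab] jacobi_int_Suc_Suc)
  then show ?thesis by simp
qed

lemma pearson_op_smult: "pearson_op a b (smult c r) = smult c (pearson_op a b r)"
  by (simp add: pearson_op_def pderiv_smult smult_add_right del: mult_pCons_left)

lemma pearson_op_sum_smult:
  "pearson_op a b (\<Sum>i\<in>A. smult (c i) (f i)) = (\<Sum>i\<in>A. smult (c i) (pearson_op a b (f i)))"
  by (induction A rule: infinite_finite_induct)
     (simp_all add: pearson_op_def pderiv_add pderiv_smult ring_distribs smult_add_right
      del: mult_pCons_left)

text \<open>With \<open>U = (x - 1) / 2\<close> and \<open>V = (x + 1) / 2\<close> one has \<open>1 - x\<^sup>2 = -4 U V\<close> and \<open>U' = V' = 1/2\<close>, so the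
operator acts on the products in which the Jacobi polynomials are expanded by two terms only.\<close>

lemma pearson_op_endpoint_powers:
  fixes a b :: real
  defines "U \<equiv> [:-1/2, 1/2:]" and "V \<equiv> [:1/2, 1/2 :: real:]"
  shows "pearson_op a b (U ^ i * V ^ j) =
     smult (-2 * (real i + a + 1)) (U ^ i * V ^ Suc j) + smult (-2 * (real j + b + 1)) (U ^ Suc i * V ^ j)"
proof -
  have U': "pderiv U = [:1/2:]" and V': "pderiv V = [:1/2:]"
    by (simp_all add: U_def V_def pderiv_pCons)
  have UU': "U * pderiv (U ^ i) = smult (real i / 2) (U ^ i)"
    by (cases i) (simp_all add: pderiv_power U' mult_ac del: power_Suc, simp_all)
  have VV': "V * pderiv (V ^ j) = smult (real j / 2) (V ^ j)"
    by (cases j) (simp_all add: pderiv_power V' mult_ac del: power_Suc, simp_all)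
  have UV: "[:1, 0, -1:] = smult (-4) (U * V)"
    by (simp add: U_def V_def)
  have lin: "[:b - a, -(a + b + 2):] = smult (-2 * (a + 1)) V + smult (-2 * (b + 1)) U"
    by (simp add: U_def V_def field_simps)
  have "[:1, 0, -1:] * pderiv (U ^ i * V ^ j) =
      smult (-4) (U ^ Suc i * (V * pderiv (V ^ j)) + V ^ Suc j * (U * pderiv (U ^ i)))"
    by (simp add: UV pderiv_mult algebra_simps smult_add_right)
  also have "\<dots> = smult (-2 * real j) (U ^ Suc i * V ^ j) + smult (-2 * real i) (U ^ i * V ^ Suc j)"
    by (simp add: UU' VV' smult_add_right algebra_simps)
  finally have *: "[:1, 0, -1:] * pderiv (U ^ i * V ^ j) =
      smult (-2 * real j) (U ^ Suc i * V ^ j) + smult (-2 * real i) (U ^ i * V ^ Suc j)" .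
  show ?thesis
    unfolding pearson_op_def lin *
    by (subst poly_eq_poly_eq_iff[symmetric], intro ext) (simp add: algebra_simps)
qed

text \<open>One step of the Rodrigues formula. Comparing coefficients of \<open>U\<^sup>s V\<^sup>n\<^sup>-\<^sup>s\<close>, the two absorption
identities for binomial coefficients give contributions proportional to \<open>n - s\<close> and \<open>s\<close>, whose sum
is \<open>n\<close>.\<close>

lemma pearson_op_jacobi_P:
  "pearson_op a b (jacobi_P (a + 1) (b + 1) m) = smult (-2 * real (Suc m)) (jacobi_P a b (Suc m))"
proof -
  define U where "U = [:-1/2, 1/2::real:]"
  define V where "V = [:1/2, 1/2::real:]"
  define n where "n = Suc m"
  define c where "c s = ((real n + a) gchoose (n - s)) * ((real n + b) gchoose s)" for s
  define e where "e s = U ^ s * V ^ (n - s)" for s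
  have P: "jacobi_P a b n = (\<Sum>s\<le>n. smult (c s) (e s))"
    by (simp add: jacobi_P_def c_def e_def U_def V_def)
  have step: "smult (((real m + (a + 1)) gchoose (m - s)) * ((real m + (b + 1)) gchoose s))
      (pearson_op a b (U ^ s * V ^ (m - s))) =
      smult (-2 * real (n - s) * c s) (e s) + smult (-2 * real (Suc s) * c (Suc s)) (e (Suc s))"
    if "s \<le> m" for s
  proof -
    have e: "n - s = Suc (m - s)" "n - Suc s = m - s" "real m = real n - 1"
      using that by (auto simp: n_def)
    have "((real n + a) - real (m - s)) * ((real n + a) gchoose (m - s))
        = real (n - s) * ((real n + a) gchoose (n - s))"
      using gbinomial_mult_1[of "real n + a" "m - s"] unfolding e(1) by (simp add: algebra_simps)
    moreover have "(real n + a) - real (m - s) = real s + a + 1"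
      using that by (simp add: n_def of_nat_diff)
    ultimately have A: "(real s + a + 1) * ((real n + a) gchoose (m - s))
        = real (n - s) * ((real n + a) gchoose (n - s))" by simp
    have "((real n + b) - real s) * ((real n + b) gchoose s)
        = real (Suc s) * ((real n + b) gchoose (Suc s))"
      using gbinomial_mult_1[of "real n + b" s] by (simp add: algebra_simps)
    moreover have "(real n + b) - real s = real (m - s) + b + 1"
      using that by (simp add: n_def of_nat_diff)
    ultimately have B: "(real (m - s) + b + 1) * ((real n + b) gchoose s)
        = real (Suc s) * ((real n + b) gchoose (Suc s))" by simp
    have g: "real m + (a + 1) = real n + a" "real m + (b + 1) = real n + b"
      by (auto simp: n_def)
    have 1: "((real n + a) gchoose (m - s)) * ((real n + b) gchoose s) * (-2 * (real s + a + 1))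
       = -2 * real (n - s) * c s"
      unfolding c_def using A by (simp only: mult_ac)
    have 2: "((real n + a) gchoose (m - s)) * ((real n + b) gchoose s) * (-2 * (real (m - s) + b + 1))
       = -2 * real (Suc s) * c (Suc s)"
      unfolding c_def e(2) using B by (simp only: mult_ac) algebra
    show ?thesis
      unfolding g U_def V_def pearson_op_endpoint_powers smult_add_right smult_smult 1 2
      by (simp add: e_def U_def V_def e)
  qed
  have "pearson_op a b (jacobi_P (a + 1) (b + 1) m) =
    (\<Sum>s\<le>m. smult (-2 * real (n - s) * c s) (e s)) + (\<Sum>s\<le>m. smult (-2 * real (Suc s) * c (Suc s)) (e (Suc s)))"
    unfolding jacobi_P_def pearson_op_sum_smult U_def[symmetric] V_def[symmetric]
    by (simp add: step flip: sum.distrib)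
  also have "(\<Sum>s\<le>m. smult (-2 * real (n - s) * c s) (e s)) = (\<Sum>s\<le>n. smult (-2 * real (n - s) * c s) (e s))"
    by (simp add: n_def)
  also have "(\<Sum>s\<le>m. smult (-2 * real (Suc s) * c (Suc s)) (e (Suc s))) = (\<Sum>s\<le>n. smult (-2 * real s * c s) (e s))"
    unfolding n_def by (subst sum.atMost_Suc_shift) simp
  also have "(\<Sum>s\<le>n. smult (-2 * real (n - s) * c s) (e s)) + (\<Sum>s\<le>n. smult (-2 * real s * c s) (e s)) =
     (\<Sum>s\<le>n. smult (-2 * real n * c s) (e s))"
    unfolding sum.distrib[symmetric] smult_add_left[symmetric]
    by (intro sum.cong refl arg_cong2[of _ _ _ _ smult]) (auto simp: of_nat_diff algebra_simps)
  also have "\<dots> = smult (-2 * real n) (jacobi_P a b n)"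
    unfolding P by (subst poly_eq_poly_eq_iff[symmetric]) (simp add: fun_eq_iff poly_sum sum_distrib_left sum_negf mult.assoc)
  finally show ?thesis by (simp add: n_def)
qed

text \<open>Integrating the Rodrigues step by parts moves one derivative onto \<open>q\<close> and lowers the degree of
the Jacobi polynomial; after \<open>n\<close> steps nothing is left of \<open>q\<close>.\<close>

lemma jacobi_P_orthogonal:
  assumes "a > -1" "b > -1" "degree q < n"
  shows "jacobi_int a b (jacobi_P a b n * q) = 0"
  using assms
proof (induction n arbitrary: a b q)
  case (Suc m)
  have *: "jacobi_int (a + 1) (b + 1) (jacobi_P (a + 1) (b + 1) m * pderiv q) = 0"
  proof (cases "pderiv q = 0")
    case False
    then have "degree q \<noteq> 0" by (auto simp: pderiv_eq_0_iff)
    then have "degree (pderiv q) < m" using Suc.prems by (simp add: degree_pderiv)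
    then show ?thesis using Suc by (intro Suc.IH) auto
  qed (simp add: jacobi_int_def)
  have "-2 * real (Suc m) * jacobi_int a b (jacobi_P a b (Suc m) * q) = 0"
    using jacobi_int_by_parts[OF Suc.prems(1,2), of "jacobi_P (a+1) (b+1) m" q] * Suc.prems
    by (simp add: pearson_op_jacobi_P jacobi_int_smult)
  then show ?case by simp
qed auto

lemma degree_jacobi_P_le: "degree (jacobi_P a b n) \<le> n"
  unfolding jacobi_P_def
proof (intro degree_sum_le ballI)
  fix s assume "s \<in> {..n}"
  have "degree ([:-1/2, 1/2::real:] ^ s * [:1/2, 1/2:] ^ (n - s)) \<le> s + (n - s)"
    by (rule order.trans[OF degree_mult_le])
       (intro add_mono order.trans[OF degree_power_le]; simp)
  then show "degree (smult ((real n + a gchoose (n - s)) * (real n + b gchoose s))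
      ([:-1/2, 1/2:] ^ s * [:1/2, 1/2:] ^ (n - s))) \<le> n"
    using \<open>s \<in> {..n}\<close> by (intro order.trans[OF degree_smult_le]) auto
qed auto

text \<open>Only the term \<open>s = 0\<close> survives at \<open>x = 1\<close>; its coefficient is a product of positive factors.
This is what rules out the zero polynomial.\<close>

lemma poly_jacobi_P_1_pos:
  assumes "a > -1"
  shows "poly (jacobi_P a b n) 1 > 0"
proof -
  have "poly (jacobi_P a b n) 1 = (\<Sum>s\<le>n. ((real n + a) gchoose (n - s)) * ((real n + b) gchoose s) * 0 ^ s)"
    by (simp add: jacobi_P_def poly_sum)
  also have "\<dots> = ((real n + a) gchoose n)"
    by (subst sum.remove[of _ 0]) (auto simp: power_0_left)
  also have "\<dots> > 0"
    unfolding gbinomial_prod_rev using assms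
    by (intro divide_pos_pos prod_pos) auto
  finally show ?thesis .
qed

text \<open>A drop of the degree would make the polynomial orthogonal to itself, which positivity excludes.
This avoids evaluating the leading coefficient.\<close>

lemma degree_jacobi_P:
  assumes "a > -1" "b > -1"
  shows "degree (jacobi_P a b n) = n"
proof (rule ccontr)
  assume "degree (jacobi_P a b n) \<noteq> n"
  then have "degree (jacobi_P a b n) < n" using degree_jacobi_P_le[of a b n] by simp
  from jacobi_P_orthogonal[OF assms this] have "jacobi_P a b n = 0"
    using jacobi_int_square_pos[OF assms, of "jacobi_P a b n"] by force
  then show False using poly_jacobi_P_1_pos[OF assms(1), of b n] by simp
qed

section \<open>Orthonormal Jacobi polynomials\<close>

definition jacobi_mean :: "real \<Rightarrow> real \<Rightarrow> real poly \<Rightarrow> real" where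
  "jacobi_mean a b p = jacobi_c a b * jacobi_int a b p"

lemma jacobi_orthonormal_iff:
  "jacobi_orthonormal a b p \<longleftrightarrow>
     (\<forall>m. degree (p m) = m \<and> lead_coeff (p m) > 0) \<and>
     (\<forall>m l. jacobi_mean a b (p m * p l) = (if m = l then 1 else 0))"
  by (simp add: jacobi_orthonormal_def jacobi_mean_def jacobi_int_def)

lemma graded_basis_expansion:
  fixes p :: "nat \<Rightarrow> real poly"
  assumes "\<And>i. degree (p i) = i" "\<And>i. p i \<noteq> 0" "\<And>i. i \<ge> n \<Longrightarrow> coeff f i = 0"
  shows "\<exists>a. f = (\<Sum>i<n. smult (a i) (p i))"
  using assms(3)
proof (induction n arbitrary: f)
  case 0
  then show ?case by (auto intro: poly_eqI)
next
  case (Suc n)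
  define c where "c = coeff f n / lead_coeff (p n)"
  have "coeff (f - smult c (p n)) i = 0" if "i \<ge> n" for i
    using that Suc.prems[of i] assms(1)[of n] leading_coeff_0_iff[of "p n"] assms(2)[of n]
    by (cases "i = n") (auto simp: c_def coeff_eq_0)
  from Suc.IH[OF this] obtain a where a: "f - smult c (p n) = (\<Sum>i<n. smult (a i) (p i))" by auto
  show ?case
    by (rule exI[of _ "a(n := c)"]) (simp add: a[symmetric])
qed

text \<open>Subtracting the multiple with the same top coefficient leaves a polynomial of lower degree that
is orthogonal to itself.\<close>

lemma scalar_multiple_of_jacobi_P:
  assumes ab: "a > -1" "b > -1" and "degree f \<le> n"
    and orth: "\<And>q. degree q < n \<Longrightarrow> jacobi_int a b (f * q) = 0"
  shows "\<exists>c. f = smult c (jacobi_P a b n)"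
proof -
  define P where "P = jacobi_P a b n"
  have P: "degree P = n" "P \<noteq> 0"
    using degree_jacobi_P[OF ab, of n] poly_jacobi_P_1_pos[OF ab(1), of b n] by (auto simp: P_def)
  define g where "g = f - smult (coeff f n / lead_coeff P) P"
  have "g = 0"
  proof (rule ccontr)
    assume "g \<noteq> 0"
    have "degree g \<le> n" using P assms(3) unfolding g_def by (intro degree_diff_le) auto
    moreover have "coeff g n = 0" using P by (auto simp: g_def)
    ultimately have "degree g < n"
      using \<open>g \<noteq> 0\<close> by (metis le_neq_implies_less leading_coeff_0_iff)
    have "jacobi_int a b (g * g) = jacobi_int a b (f * g) - coeff f n / lead_coeff P * jacobi_int a b (P * g)"
      unfolding g_def by (simp add: jacobi_int_diff[OF ab] jacobi_int_smult[OF ab] left_diff_distrib)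
    also have "\<dots> = 0"
      using orth[OF \<open>degree g < n\<close>] jacobi_P_orthogonal[OF ab \<open>degree g < n\<close>] by (simp add: P_def)
    finally show False using jacobi_int_square_pos[OF ab \<open>g \<noteq> 0\<close>] by simp
  qed
  then show ?thesis by (auto simp: g_def P_def)
qed

context
  fixes a b :: real
  assumes ab: "a > -1" "b > -1"
begin

lemma jacobi_mean_add: "jacobi_mean a b (p + q) = jacobi_mean a b p + jacobi_mean a b q"
  by (simp add: jacobi_mean_def jacobi_int_add[OF ab] algebra_simps)

lemma jacobi_mean_smult: "jacobi_mean a b (smult c p) = c * jacobi_mean a b p"
  by (simp add: jacobi_mean_def jacobi_int_smult[OF ab] algebra_simps)

lemma jacobi_mean_sum: "jacobi_mean a b (sum f A) = (\<Sum>i\<in>A. jacobi_mean a b (f i))"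
  by (simp add: jacobi_mean_def jacobi_int_sum[OF ab] sum_distrib_left)

lemma jacobi_P_nonzero: "jacobi_P a b n \<noteq> 0"
  using poly_jacobi_P_1_pos[OF ab(1), of b n] by auto

text \<open>The classical polynomials, rescaled, already form the orthonormal sequence, so that
\<open>jacobi_p\<close> and \<open>jacobi_P\<close> have the same zeros.\<close>

lemma jacobi_orthonormal_normalised_jacobi_P:
  "jacobi_orthonormal a b (\<lambda>m. smult (sgn (lead_coeff (jacobi_P a b m))
      / sqrt (jacobi_mean a b (jacobi_P a b m * jacobi_P a b m))) (jacobi_P a b m))"
    (is "jacobi_orthonormal a b ?p")
proof -
  have pos: "jacobi_mean a b (jacobi_P a b m * jacobi_P a b m) > 0" for m
    using jacobi_c_pos[OF ab] jacobi_int_square_pos[OF ab jacobi_P_nonzero]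
    by (simp add: jacobi_mean_def)
  have lc: "lead_coeff (jacobi_P a b m) \<noteq> 0" for m
    using jacobi_P_nonzero by simp
  have deg: "degree (?p m) = m" for m
    using pos[of m] lc[of m] degree_jacobi_P[OF ab, of m] by (simp add: sgn_zero_iff)
  have lead: "lead_coeff (?p m) > 0" for m
    using pos[of m] lc[of m] by (auto simp: sgn_if divide_less_0_iff not_less le_less)
  have off: "jacobi_mean a b (jacobi_P a b m * jacobi_P a b l) = 0" if "m \<noteq> l" for m l
    using that jacobi_P_orthogonal[OF ab, of "jacobi_P a b l" m] jacobi_P_orthogonal[OF ab, of "jacobi_P a b m" l]
    by (auto simp: degree_jacobi_P[OF ab] jacobi_mean_def mult.commute neq_iff)
  have "jacobi_mean a b (?p m * ?p l) = (if m = l then 1 else 0)" for m l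
  proof (cases "m = l")
    case True
    then show ?thesis
      using pos[of m] lc[of m]
      by (auto simp: jacobi_mean_smult sgn_if real_sqrt_mult_self divide_simps)
  qed (simp add: jacobi_mean_smult off)
  then show ?thesis
    unfolding jacobi_orthonormal_iff using deg lead by blast
qed

lemma jacobi_orthonormal_orthogonal:
  assumes p: "jacobi_orthonormal a b p" and "\<And>i. i \<ge> m \<Longrightarrow> coeff q i = 0"
  shows "jacobi_mean a b (p m * q) = 0"
proof -
  have p': "degree (p i) = i" "lead_coeff (p i) > 0" for i
    using p unfolding jacobi_orthonormal_iff by blast+
  then have "p i \<noteq> 0" for i by (metis leading_coeff_0_iff less_irrefl)
  from graded_basis_expansion[of p, OF p'(1) this assms(2)]
  obtain c where c: "q = (\<Sum>i<m. smult (c i) (p i))" by auto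
  have "jacobi_mean a b (p m * p i) = 0" if "i < m" for i
    using p that by (auto simp: jacobi_orthonormal_iff)
  then show ?thesis
    by (simp add: c sum_distrib_left jacobi_mean_sum jacobi_mean_smult)
qed

lemma jacobi_orthonormal_unique:
  assumes p: "jacobi_orthonormal a b p" and q: "jacobi_orthonormal a b q"
  shows "p = q"
proof
  fix m
  have multiple: "\<exists>c. r m = smult c (jacobi_P a b m)" if r: "jacobi_orthonormal a b r" for r
  proof (rule scalar_multiple_of_jacobi_P[OF ab])
    show "degree (r m) \<le> m" using r by (simp add: jacobi_orthonormal_iff)
    fix f :: "real poly" assume "degree f < m"
    then have "jacobi_mean a b (r m * f) = 0"
      by (intro jacobi_orthonormal_orthogonal[OF r]) (auto simp: coeff_eq_0)
    then show "jacobi_int a b (r m * f) = 0"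
      using jacobi_c_pos[OF ab] by (simp add: jacobi_mean_def)
  qed
  from multiple[OF p] multiple[OF q] obtain c d
    where c: "p m = smult c (jacobi_P a b m)" and d: "q m = smult d (jacobi_P a b m)" by auto
  have lead: "lead_coeff (p m) > 0" "lead_coeff (q m) > 0"
    using p q unfolding jacobi_orthonormal_iff by blast+
  then have sgn: "c * lead_coeff (jacobi_P a b m) > 0" "d * lead_coeff (jacobi_P a b m) > 0"
    by (simp_all only: c d lead_coeff_smult)
  have "jacobi_mean a b (p m * p m) = 1" "jacobi_mean a b (q m * q m) = 1"
    using p q by (auto simp: jacobi_orthonormal_iff)
  then have "c * (c * jacobi_mean a b (jacobi_P a b m * jacobi_P a b m)) = 1"
    "d * (d * jacobi_mean a b (jacobi_P a b m * jacobi_P a b m)) = 1"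
    by (simp_all add: c d jacobi_mean_smult)
  moreover define S where "S = jacobi_mean a b (jacobi_P a b m * jacobi_P a b m)"
  ultimately have "c\<^sup>2 * S = 1" "d\<^sup>2 * S = 1"
    by (simp_all add: power2_eq_square mult.assoc)
  then have "c\<^sup>2 = 1 / S" "d\<^sup>2 = 1 / S"
    by (auto simp: eq_divide_eq)
  then have "c\<^sup>2 = d\<^sup>2" by simp
  moreover have "c * d > 0"
    using sgn by (auto simp: zero_less_mult_iff)
  ultimately have "c = d"
    by (auto simp: power2_eq_iff mult_less_0_iff zero_less_mult_iff)
  then show "p m = q m" by (simp add: c d)
qed

lemma jacobi_p_eq: "jacobi_p a b = (\<lambda>m. smult (sgn (lead_coeff (jacobi_P a b m))
      / sqrt (jacobi_mean a b (jacobi_P a b m * jacobi_P a b m))) (jacobi_P a b m))"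
  unfolding jacobi_p_def
  by (rule the_equality[where P = "jacobi_orthonormal a b"])
    (rule jacobi_orthonormal_normalised_jacobi_P, blast intro: jacobi_orthonormal_unique
       jacobi_orthonormal_normalised_jacobi_P)

lemma jacobi_orthonormal_jacobi_p: "jacobi_orthonormal a b (jacobi_p a b)"
  unfolding jacobi_p_eq by (rule jacobi_orthonormal_normalised_jacobi_P)

lemma jacobi_p_multiple: "\<exists>c. jacobi_p a b m = smult c (jacobi_P a b m)"
  by (auto simp: jacobi_p_eq)

lemma degree_jacobi_p [simp]: "degree (jacobi_p a b m) = m"
  and jacobi_p_nonzero [simp]: "jacobi_p a b m \<noteq> 0"
  and jacobi_mean_jacobi_p: "jacobi_mean a b (jacobi_p a b i * jacobi_p a b j) = (if i = j then 1 else 0)"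
  using jacobi_orthonormal_jacobi_p by (auto simp: jacobi_orthonormal_iff dest: spec[of _ m])

lemmas jacobi_p_orthogonal = jacobi_orthonormal_orthogonal[OF jacobi_orthonormal_jacobi_p]

end

section \<open>Lagrange interpolation and Gauss quadrature at the Jacobi zeros\<close>

lemma real_poly_eqI:
  fixes p q :: "real poly"
  assumes "\<And>x. poly p x = poly q x"
  shows "p = q"
  using assms by (subst poly_eq_poly_eq_iff[symmetric]) auto

lemma smult_sum_right: "smult c (sum f A) = (\<Sum>i\<in>A. smult c (f i))"
  by (induction A rule: infinite_finite_induct) (auto simp: smult_add_right)

definition lagrange_basis :: "(nat \<Rightarrow> real) \<Rightarrow> nat \<Rightarrow> nat \<Rightarrow> real poly" where
  "lagrange_basis X n k = (\<Prod>i\<in>{1..n} - {k}. smult (1 / (X k - X i)) [:- X i, 1:])"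

lemma degree_lagrange_basis: "k \<in> {1..n} \<Longrightarrow> degree (lagrange_basis X n k) < n"
proof -
  assume k: "k \<in> {1..n}"
  have "degree (lagrange_basis X n k) \<le> (\<Sum>i\<in>{1..n} - {k}. degree (smult (1 / (X k - X i)) [:- X i, 1:]))"
    unfolding lagrange_basis_def by (rule degree_prod_sum_le[unfolded o_def]) simp
  also have "\<dots> \<le> (\<Sum>i\<in>{1..n} - {k}. 1)"
    by (intro sum_mono order.trans[OF degree_smult_le]) simp
  also have "\<dots> < n" using k by simp
  finally show ?thesis .
qed

lemma poly_lagrange_basis:
  assumes "inj_on X {1..n}" "k \<in> {1..n}" "j \<in> {1..n}"
  shows "poly (lagrange_basis X n k) (X j) = (if j = k then 1 else 0)"
proof (cases "j = k")
  case True
  have "X k \<noteq> X i" if "i \<in> {1..n} - {k}" for i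
    using inj_onD[OF assms(1), of k i] assms(2) that by blast
  then show ?thesis
    using True unfolding lagrange_basis_def poly_prod
    by (intro trans[OF prod.neutral]) (auto simp flip: diff_divide_distrib)
next
  case False
  then have "poly (lagrange_basis X n k) (X j) = 0"
    using assms by (auto simp: lagrange_basis_def poly_prod)
  then show ?thesis using False by simp
qed

lemma lagrange_interpolation:
  assumes inj: "inj_on X {1..n}" and deg: "degree f < n"
  shows "f = (\<Sum>k=1..n. smult (poly f (X k)) (lagrange_basis X n k))" (is "f = ?g")
proof (rule ccontr)
  assume ne: "f \<noteq> ?g"
  have "degree (smult (poly f (X k)) (lagrange_basis X n k)) \<le> n - 1" if "k \<in> {1..n}" for k
    using degree_lagrange_basis[OF that, of X] by (intro order.trans[OF degree_smult_le]) simp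
  then have "degree ?g \<le> n - 1" by (intro degree_sum_le) auto
  then have "degree (f - ?g) \<le> n - 1" using deg by (intro degree_diff_le) auto
  moreover have "poly (f - ?g) (X j) = 0" if "j \<in> {1..n}" for j
  proof -
    have "poly ?g (X j) = (\<Sum>k=1..n. poly f (X k) * (if j = k then 1 else 0))"
      using that by (simp add: poly_sum poly_lagrange_basis[OF inj])
    then show ?thesis using that by (simp add: if_distrib cong: if_cong)
  qed
  then have "X ` {1..n} \<subseteq> {x. poly (f - ?g) x = 0}" by auto
  then have "card (X ` {1..n}) \<le> card {x. poly (f - ?g) x = 0}"
    using ne by (intro card_mono poly_roots_finite) auto
  then have "n \<le> degree (f - ?g)"
    using card_poly_roots_bound[of "f - ?g"] ne card_image[OF inj] by simp
  ultimately show False using deg by simp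
qed

text \<open>If the \<open>p i\<close> are orthogonal for a discrete inner product carried by the nodes, then the Fourier
coefficients of a Lagrange basis polynomial are single terms, and the expansion exhibits it as the
discrete reproducing kernel with one argument frozen at a node.\<close>

lemma lagrange_basis_discrete_expansion:
  fixes p :: "nat \<Rightarrow> real poly"
  assumes inj: "inj_on X {1..n}" and k: "k \<in> {1..n}"
    and p: "\<And>i. degree (p i) = i" "\<And>i. p i \<noteq> 0"
    and orth: "\<And>i j. i < n \<Longrightarrow> j < n \<Longrightarrow>
        (\<Sum>l=1..n. \<omega> l * (poly (p i) (X l) * poly (p j) (X l))) = (if i = j then \<mu> i else 0)"
    and \<mu>: "\<And>i. i < n \<Longrightarrow> \<mu> i \<noteq> 0"
  shows "lagrange_basis X n k = (\<Sum>i<n. smult (\<omega> k * poly (p i) (X k) / \<mu> i) (p i))"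
proof -
  have "coeff (lagrange_basis X n k) i = 0" if "i \<ge> n" for i
    using degree_lagrange_basis[OF k, of X] that by (intro coeff_eq_0) simp
  from graded_basis_expansion[OF p this] obtain c
    where c: "lagrange_basis X n k = (\<Sum>i<n. smult (c i) (p i))" by blast
  have "c j = \<omega> k * poly (p j) (X k) / \<mu> j" if j: "j < n" for j
  proof -
    have "\<omega> k * poly (p j) (X k) = (\<Sum>l=1..n. if l = k then \<omega> l * poly (p j) (X l) else 0)"
      using k by simp
    also have "\<dots> = (\<Sum>l=1..n. \<omega> l * (poly (lagrange_basis X n k) (X l) * poly (p j) (X l)))"
      by (intro sum.cong) (auto simp: poly_lagrange_basis[OF inj k])
    also have "\<dots> = (\<Sum>l=1..n. \<Sum>i<n. c i * (\<omega> l * (poly (p i) (X l) * poly (p j) (X l))))"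
      by (simp add: c poly_sum sum_distrib_left sum_distrib_right mult_ac)
    also have "\<dots> = (\<Sum>i<n. c i * (\<Sum>l=1..n. \<omega> l * (poly (p i) (X l) * poly (p j) (X l))))"
      by (subst sum.swap) (simp add: sum_distrib_left)
    also have "\<dots> = (\<Sum>i<n. c i * (if i = j then \<mu> i else 0))"
      using orth j by (intro sum.cong) auto
    also have "\<dots> = c j * \<mu> j" using j by (simp add: if_distrib cong: if_cong)
    finally show ?thesis using \<mu>[OF j] by (simp add: field_simps)
  qed
  then show ?thesis unfolding c by (intro sum.cong) auto
qed

definition kernel_poly :: "real \<Rightarrow> real \<Rightarrow> nat \<Rightarrow> real \<Rightarrow> real poly" where
  "kernel_poly a b m y = (\<Sum>i<m. smult (poly (jacobi_p a b i) y) (jacobi_p a b i))"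

lemma poly_kernel_poly: "poly (kernel_poly a b m y) x = jacobi_k a b (int m - 1) x y"
  by (simp add: kernel_poly_def jacobi_k_def poly_sum mult_ac)

text \<open>The bijection says in particular that there are \<open>n\<close> distinct real zeros \<open>X k = cos (\<theta> k)\<close>, as many
as a Gauss rule of exactness degree \<open>2n - 1\<close> needs.\<close>

locale jacobi_nodes =
  fixes \<alpha> \<beta> :: real and n :: nat and \<theta> :: "nat \<Rightarrow> real"
  assumes \<alpha>: "\<alpha> > -1" and \<beta>: "\<beta> > -1" and n: "n \<ge> 1"
    and \<theta>: "\<And>k. k \<in> {1..n} \<Longrightarrow> 0 < \<theta> k \<and> \<theta> k < pi"
    and roots: "bij_betw (\<lambda>k. cos (\<theta> k)) {1..n} {x. poly (jacobi_P \<alpha> \<beta> n) x = 0}"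
begin

abbreviation X :: "nat \<Rightarrow> real" where "X k \<equiv> cos (\<theta> k)"

abbreviation L :: "nat \<Rightarrow> real poly" where "L k \<equiv> lagrange_basis (\<lambda>k. cos (\<theta> k)) n k"

text \<open>Gauss weights as means of the Lagrange basis; \<open>w_eq_gauss_lambda\<close> identifies them with the
Christoffel numbers.\<close>

definition w :: "nat \<Rightarrow> real" where "w k = jacobi_mean \<alpha> \<beta> (L k)"

lemma inj_X: "inj_on (\<lambda>k. cos (\<theta> k)) {1..n}"
  using roots by (rule bij_betw_imp_inj_on)

lemma root_X: "k \<in> {1..n} \<Longrightarrow> poly (jacobi_P \<alpha> \<beta> n) (X k) = 0"
  using bij_betw_apply[OF roots] by blast

text \<open>Divide by the Jacobi polynomial: the quotient part integrates to zero by orthogonality and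
vanishes at the nodes, and the remainder is interpolated exactly.\<close>

lemma gauss_quadrature:
  assumes deg: "degree f \<le> 2 * n - 1"
  shows "jacobi_mean \<alpha> \<beta> f = (\<Sum>k=1..n. w k * poly f (X k))"
proof -
  define P where "P = jacobi_P \<alpha> \<beta> n"
  have P: "degree P = n" "P \<noteq> 0"
    using degree_jacobi_P[OF \<alpha> \<beta>] jacobi_P_nonzero[OF \<alpha> \<beta>] by (auto simp: P_def)
  define q where "q = f div P"
  define r where "r = f mod P"
  have f: "f = P * q + r" by (simp add: q_def r_def)
  have r: "degree r < n"
    using degree_mod_less[of P f] P n by (auto simp: r_def)
  have "degree q < n"
  proof (cases "q = 0")
    case False
    then have "degree (P * q) = n + degree q" using P by (simp add: degree_mult_eq)
    then have "degree f = n + degree q" unfolding f using r by (subst degree_add_eq_left) auto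
    then show ?thesis using deg n by simp
  qed (use n in simp)
  then have "jacobi_mean \<alpha> \<beta> f = jacobi_mean \<alpha> \<beta> r"
    using jacobi_P_orthogonal[OF \<alpha> \<beta>, of q n]
    by (simp add: f jacobi_mean_add[OF \<alpha> \<beta>] P_def) (simp add: jacobi_mean_def)
  also have "\<dots> = (\<Sum>k=1..n. w k * poly r (X k))"
    unfolding w_def
    by (rule trans[OF arg_cong[of _ _ "jacobi_mean \<alpha> \<beta>", OF lagrange_interpolation[OF inj_X r]]])
       (simp add: jacobi_mean_sum[OF \<alpha> \<beta>] jacobi_mean_smult[OF \<alpha> \<beta>] mult.commute)
  also have "\<dots> = (\<Sum>k=1..n. w k * poly f (X k))"
    using root_X by (intro sum.cong) (auto simp: f P_def)
  finally show ?thesis .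
qed

lemma L_kernel:
  assumes k: "k \<in> {1..n}"
  shows "L k = smult (w k) (kernel_poly \<alpha> \<beta> n (X k))"
proof -
  have "L k = (\<Sum>i<n. smult (w k * poly (jacobi_p \<alpha> \<beta> i) (X k) / 1) (jacobi_p \<alpha> \<beta> i))"
  proof (rule lagrange_basis_discrete_expansion[OF inj_X k])
    fix i j assume "i < n" "j < n"
    then have "degree (jacobi_p \<alpha> \<beta> i * jacobi_p \<alpha> \<beta> j) \<le> 2 * n - 1"
      by (simp add: degree_mult_eq \<alpha> \<beta>)
    from gauss_quadrature[OF this]
    show "(\<Sum>l=1..n. w l * (poly (jacobi_p \<alpha> \<beta> i) (X l) * poly (jacobi_p \<alpha> \<beta> j) (X l)))
        = (if i = j then 1 else 0)"
      by (simp add: jacobi_mean_jacobi_p[OF \<alpha> \<beta>])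
  qed (simp_all add: \<alpha> \<beta>)
  then show ?thesis
    by (simp add: kernel_poly_def smult_sum_right mult_ac)
qed

text \<open>The last summand of the kernel of order \<open>n\<close> vanishes at a node, so the kernel has there the
same diagonal value as the one of order \<open>n - 1\<close>, and that value is read off from \<open>L_kernel\<close>.\<close>

lemma w_eq_gauss_lambda:
  assumes k: "k \<in> {1..n}"
  shows "w k = gauss_lambda \<alpha> \<beta> n (X k)" "w k \<noteq> 0"
proof -
  obtain c where "jacobi_p \<alpha> \<beta> n = smult c (jacobi_P \<alpha> \<beta> n)"
    using jacobi_p_multiple[OF \<alpha> \<beta>] by blast
  then have 0: "poly (jacobi_p \<alpha> \<beta> n) (X k) = 0" using root_X[OF k] by simp
  have "1 = w k * poly (kernel_poly \<alpha> \<beta> n (X k)) (X k)"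
    using poly_lagrange_basis[OF inj_X k k] L_kernel[OF k] by simp
  also have "poly (kernel_poly \<alpha> \<beta> n (X k)) (X k) = jacobi_k \<alpha> \<beta> (int n) (X k) (X k)"
    unfolding poly_kernel_poly using 0 by (simp add: jacobi_k_def nat_add_distrib)
  finally have "jacobi_k \<alpha> \<beta> (int n) (X k) (X k) * w k = 1" by (simp add: mult.commute)
  then show "w k = gauss_lambda \<alpha> \<beta> n (X k)" "w k \<noteq> 0"
    unfolding gauss_lambda_def by (auto dest: inverse_unique)
qed

lemma jacobi_mean_shift_quadrature:
  assumes "jacobi_int a b f = jacobi_int \<alpha> \<beta> (h * f)" "degree (h * f) \<le> 2 * n - 1"
  shows "(\<Sum>l=1..n. jacobi_c a b / jacobi_c \<alpha> \<beta> * w l * poly h (X l) * poly f (X l)) = jacobi_mean a b f"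
proof -
  have "(\<Sum>l=1..n. jacobi_c a b / jacobi_c \<alpha> \<beta> * w l * poly h (X l) * poly f (X l))
      = jacobi_c a b / jacobi_c \<alpha> \<beta> * jacobi_mean \<alpha> \<beta> (h * f)"
    unfolding gauss_quadrature[OF assms(2)] by (simp add: sum_distrib_left mult_ac)
  then show ?thesis
    using assms(1) jacobi_c_pos[OF \<alpha> \<beta>] by (simp add: jacobi_mean_def)
qed

text \<open>Multiplying the weight by a linear factor \<open>h\<close> keeps all products \<open>h p\<^sub>i p\<^sub>j\<close> with \<open>i, j < n\<close> within
the exactness degree \<open>2n - 1\<close>. Hence the Lagrange basis is also given by the kernel of the modified
weight.\<close>

lemma L_kernel_linear_modification:
  assumes k: "k \<in> {1..n}" and ab: "a > -1" "b > -1" and h: "degree h = 1"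
    and shift: "\<And>f. jacobi_int a b f = jacobi_int \<alpha> \<beta> (h * f)"
  shows "L k = smult (jacobi_c a b / jacobi_c \<alpha> \<beta> * w k * poly h (X k)) (kernel_poly a b n (X k))"
proof -
  have "L k = (\<Sum>i<n. smult ((jacobi_c a b / jacobi_c \<alpha> \<beta> * w k * poly h (X k)) *
      poly (jacobi_p a b i) (X k) / 1) (jacobi_p a b i))"
  proof (rule lagrange_basis_discrete_expansion[OF inj_X k])
    fix i j assume "i < n" "j < n"
    then have "degree (h * (jacobi_p a b i * jacobi_p a b j)) \<le> 2 * n - 1"
      using h ab by (intro order.trans[OF degree_mult_le]) (auto simp: degree_mult_eq)
    from jacobi_mean_shift_quadrature[OF shift this]
    show "(\<Sum>l=1..n. (jacobi_c a b / jacobi_c \<alpha> \<beta> * w l * poly h (X l)) *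
       (poly (jacobi_p a b i) (X l) * poly (jacobi_p a b j) (X l)))
        = (if i = j then 1 else 0)"
      by (simp add: jacobi_mean_jacobi_p[OF ab])
  qed (simp_all add: ab)
  then show ?thesis
    by (simp add: kernel_poly_def smult_sum_right mult_ac)
qed

text \<open>For the factor \<open>1 - x\<^sup>2\<close> exactly one product exceeds the exactness degree: the square of
\<open>\<pi> = p\<^sub>n\<^sub>-\<^sub>1\<close>, giving degree \<open>2n\<close>. Its discrete norm is computed by trading degree against a function
that vanishes at the nodes: \<open>D = pearson_op \<alpha> \<beta> \<pi>\<close> is a multiple of the degree \<open>n\<close> Jacobi polynomial by
the Rodrigues step, and \<open>N (1 - x\<^sup>2) \<pi> - x D\<close> has degree at most \<open>n\<close>. So Gauss quadrature applies after
subtracting a multiple of \<open>x \<pi> D\<close>, and the integral of that product follows by parts. The resulting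
norm \<open>1 + n / N\<close> is the origin of the rational factors in \<open>K_star\<close>.\<close>

lemma quadratic_modification_norm:
  defines "p \<equiv> jacobi_p (\<alpha> + 1) (\<beta> + 1)" and "N \<equiv> real n + \<alpha> + \<beta> + 1"
  shows "(\<Sum>l=1..n. jacobi_c (\<alpha> + 1) (\<beta> + 1) / jacobi_c \<alpha> \<beta> * w l * poly [:1, 0, -1:] (X l)
           * (poly (p (n - 1)) (X l) * poly (p (n - 1)) (X l))) = (N + real n) / N"
proof -
  define m where "m = n - 1"
  have nm: "n = Suc m" using n by (simp add: m_def)
  have ab: "\<alpha> + 1 > -1" "\<beta> + 1 > -1" using \<alpha> \<beta> by auto
  have N: "N > 0" using \<alpha> \<beta> n by (simp add: N_def)
  define \<pi> where "\<pi> = p m"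
  \<comment> \<open>The defect in Euler's relation \<open>x \<pi>' = m \<pi>\<close>, which holds for the leading term; so \<open>\<rho>\<close> has lower degree than \<open>\<pi>\<close>.\<close>
  define \<rho> where "\<rho> = [:0, 1:] * pderiv \<pi> - smult (real m) \<pi>"
  define R where "R = [:\<alpha> + \<beta> + 2, -(\<beta> - \<alpha>):] * \<pi> - [:1, 0, -1:] * \<rho>"
  define D where "D = pearson_op \<alpha> \<beta> \<pi>"
  define x where "x = [:0, 1::real:]"
  define J where "J = jacobi_int (\<alpha> + 1) (\<beta> + 1) (\<pi> * \<pi>)"
  have deg: "degree \<pi> = m" using ab by (simp add: \<pi>_def p_def)
  have \<rho>: "coeff \<rho> i = 0" if "i \<ge> m" for i
    using deg that by (cases i) (auto simp: \<rho>_def coeff_pderiv coeff_eq_0 le_less)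
  then have deg_\<rho>: "degree \<rho> \<le> m - 1"
    by (intro degree_le) auto
  have deg_\<rho>0: "\<rho> = 0" if "m = 0" using \<rho> that by (intro poly_eqI) auto
  have "degree ([:1, 0, -1:] * \<rho>) \<le> Suc m"
    using deg_\<rho> deg_\<rho>0 degree_mult_le[of "[:1, 0, -1:]" \<rho>] by (cases m) auto
  moreover have "degree ([:\<alpha> + \<beta> + 2, -(\<beta> - \<alpha>):] * \<pi>) \<le> Suc m"
    by (rule order.trans[OF degree_mult_le]) (simp add: deg)
  ultimately have deg_R: "degree R \<le> Suc m"
    unfolding R_def by (intro degree_diff_le)
  have x\<pi>: "x * pderiv \<pi> = smult (real m) \<pi> + \<rho>"
    by (simp add: \<rho>_def x_def)
  \<comment> \<open>The value of \<open>N\<close> is the one that cancels the leading coefficients.\<close>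
  have key: "smult N ([:1, 0, -1:] * \<pi>) - x * D = R"
  proof (rule real_poly_eqI)
    fix t
    have "t * poly (pderiv \<pi>) t = real m * poly \<pi> t + poly \<rho> t"
      using arg_cong[OF x\<pi>, of "\<lambda>q. poly q t"] by (simp add: x_def)
    moreover have "N = real m + \<alpha> + \<beta> + 2" by (simp add: N_def nm)
    ultimately show "poly (smult N ([:1, 0, -1:] * \<pi>) - x * D) t = poly R t"
      unfolding R_def D_def pearson_op_def x_def by simp algebra
  qed
  obtain c where c: "\<pi> = smult c (jacobi_P (\<alpha> + 1) (\<beta> + 1) m)"
    using jacobi_p_multiple[OF ab] unfolding \<pi>_def p_def by blast
  have D: "D = smult (c * (-2 * real n)) (jacobi_P \<alpha> \<beta> n)"
    unfolding D_def c pearson_op_smult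
    by (simp add: pearson_op_jacobi_P nm)
  \<comment> \<open>At a node \<open>D\<close> vanishes, so the product of degree \<open>2n\<close> may be replaced by one of degree \<open>2n - 1\<close>.\<close>
  have node: "N * poly ([:1, 0, -1:] * (\<pi> * \<pi>)) (X l) = poly (\<pi> * R) (X l)" if "l \<in> {1..n}" for l
    using arg_cong[OF key, of "\<lambda>q. poly q (X l) * poly \<pi> (X l)"] root_X[OF that]
    by (simp add: D algebra_simps)
  have "degree (\<pi> * R) \<le> 2 * n - 1"
    using deg deg_R by (intro order.trans[OF degree_mult_le]) (simp add: nm)
  from gauss_quadrature[OF this]
  have "jacobi_mean \<alpha> \<beta> (\<pi> * R) = (\<Sum>l=1..n. w l * (N * poly ([:1, 0, -1:] * (\<pi> * \<pi>)) (X l)))"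
    using node by simp
  also have "\<dots> = N * (\<Sum>l=1..n. w l * poly ([:1, 0, -1:] * (\<pi> * \<pi>)) (X l))"
    by (simp add: sum_distrib_left mult_ac)
  finally have sum: "N * (\<Sum>l=1..n. w l * poly ([:1, 0, -1:] * (\<pi> * \<pi>)) (X l)) = jacobi_mean \<alpha> \<beta> (\<pi> * R)" ..
  have "\<pi> * R = smult N ([:1, 0, -1:] * (\<pi> * \<pi>)) - D * (x * \<pi>)"
    unfolding key[symmetric] by (simp only: right_diff_distrib mult_smult_right mult_ac)
  then have "jacobi_int \<alpha> \<beta> (\<pi> * R) = N * J - jacobi_int \<alpha> \<beta> (D * (x * \<pi>))"
    by (simp add: jacobi_int_diff[OF \<alpha> \<beta>] jacobi_int_smult[OF \<alpha> \<beta>] jacobi_int_Suc_Suc J_def del: mult_pCons_left)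
  also have "jacobi_int \<alpha> \<beta> (D * (x * \<pi>)) = - jacobi_int (\<alpha> + 1) (\<beta> + 1) (\<pi> * pderiv (x * \<pi>))"
    unfolding D_def by (rule jacobi_int_by_parts[OF \<alpha> \<beta>])
  also have "pderiv (x * \<pi>) = smult (real n) \<pi> + \<rho>"
    using x\<pi> by (simp add: pderiv_mult x_def pderiv_pCons nm smult_add_left algebra_simps)
  also have "jacobi_int (\<alpha> + 1) (\<beta> + 1) (\<pi> * (smult (real n) \<pi> + \<rho>)) = real n * J"
    using jacobi_p_orthogonal[OF ab \<rho>, where m = m] jacobi_c_pos[OF ab]
    by (simp add: ring_distribs jacobi_int_add[OF ab] jacobi_int_smult[OF ab] J_def jacobi_mean_def \<pi>_def p_def)
  finally have J: "jacobi_int \<alpha> \<beta> (\<pi> * R) = (N + real n) * J" by (simp add: algebra_simps)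
  have norm: "jacobi_c (\<alpha> + 1) (\<beta> + 1) * J = 1"
    using jacobi_mean_jacobi_p[OF ab, of m m] by (simp add: J_def jacobi_mean_def \<pi>_def p_def)
  have pull: "(\<Sum>l=1..n. jacobi_c (\<alpha> + 1) (\<beta> + 1) / jacobi_c \<alpha> \<beta> * w l * poly [:1, 0, -1:] (X l)
           * (poly (p (n - 1)) (X l) * poly (p (n - 1)) (X l)))
      = jacobi_c (\<alpha> + 1) (\<beta> + 1) / jacobi_c \<alpha> \<beta> * (\<Sum>l=1..n. w l * poly ([:1, 0, -1:] * (\<pi> * \<pi>)) (X l))"
    unfolding sum_distrib_left poly_mult \<pi>_def m_def by (simp only: mult_ac)
  have moment: "(\<Sum>l=1..n. w l * poly ([:1, 0, -1:] * (\<pi> * \<pi>)) (X l)) = jacobi_c \<alpha> \<beta> * ((N + real n) * J) / N"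
    using sum N unfolding jacobi_mean_def J by (metis less_irrefl nonzero_mult_div_cancel_left)
  have "jacobi_c (\<alpha> + 1) (\<beta> + 1) / jacobi_c \<alpha> \<beta> * (jacobi_c \<alpha> \<beta> * ((N + real n) * J) / N)
      = jacobi_c (\<alpha> + 1) (\<beta> + 1) * J * ((N + real n) / N)"
    using jacobi_c_pos[OF \<alpha> \<beta>] by simp
  then show ?thesis
    unfolding pull moment norm by simp
qed

text \<open>All products but the last are integrated exactly, and the last one has norm \<open>1 + n / N\<close>. Hence
the discrete kernel is the Jacobi kernel of order \<open>n - 2\<close> plus a damped top term.\<close>

lemma L_kernel_quadratic_modification:
  assumes k: "k \<in> {1..n}"
  defines "p \<equiv> jacobi_p (\<alpha> + 1) (\<beta> + 1)"
  shows "L k = smult (jacobi_c (\<alpha> + 1) (\<beta> + 1) / jacobi_c \<alpha> \<beta> * w k * (1 - (X k)\<^sup>2))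
     (kernel_poly (\<alpha> + 1) (\<beta> + 1) (n - 1) (X k) +
      smult ((1 + \<alpha> + \<beta> + real n) / (1 + \<alpha> + \<beta> + 2 * real n) * poly (p (n - 1)) (X k)) (p (n - 1)))"
proof -
  define N where "N = real n + \<alpha> + \<beta> + 1"
  define \<mu> where "\<mu> i = (if i = n - 1 then (N + real n) / N else 1)" for i :: nat
  define \<omega> where "\<omega> l = jacobi_c (\<alpha> + 1) (\<beta> + 1) / jacobi_c \<alpha> \<beta> * w l * poly [:1, 0, -1:] (X l)" for l
  have ab: "\<alpha> + 1 > -1" "\<beta> + 1 > -1" using \<alpha> \<beta> by auto
  have N: "N > 0" using \<alpha> \<beta> n by (simp add: N_def)
  have "L k = (\<Sum>i<n. smult (\<omega> k * poly (p i) (X k) / \<mu> i) (p i))"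
  proof (rule lagrange_basis_discrete_expansion[OF inj_X k])
    fix i j assume ij: "i < n" "j < n"
    show "(\<Sum>l=1..n. \<omega> l * (poly (p i) (X l) * poly (p j) (X l))) = (if i = j then \<mu> i else 0)"
    proof (cases "i = n - 1 \<and> j = n - 1")
      case True
      then show ?thesis
        using quadratic_modification_norm by (simp add: \<omega>_def p_def \<mu>_def N_def)
    next
      case False
      have "degree ([:1, 0, -1:] * (p i * p j)) \<le> 2 * n - 1"
        using ij False ab by (intro order.trans[OF degree_mult_le]) (auto simp: degree_mult_eq p_def)
      from jacobi_mean_shift_quadrature[OF jacobi_int_Suc_Suc this]
      show ?thesis using False
        by (auto simp: jacobi_mean_jacobi_p[OF ab] p_def \<omega>_def \<mu>_def)
    qed
  qed (use ab N in \<open>auto simp: p_def \<mu>_def\<close>)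
  also have "{..<n} = insert (n - 1) {..<n - 1}" using n by auto
  also have "(\<Sum>i\<in>insert (n - 1) {..<n - 1}. smult (\<omega> k * poly (p i) (X k) / \<mu> i) (p i)) =
     smult (\<omega> k) (kernel_poly (\<alpha> + 1) (\<beta> + 1) (n - 1) (X k) + smult (N / (N + real n) * poly (p (n - 1)) (X k)) (p (n - 1)))"
    by (simp add: kernel_poly_def smult_add_right smult_sum_right \<mu>_def p_def mult_ac)
  finally show ?thesis by (simp add: N_def \<omega>_def power2_eq_square algebra_simps)
qed

end

section \<open>Symmetric functions of the difference and sum angles as plane polynomials\<close>

text \<open>Restrict to a line through the origin: the restriction is a univariate polynomial with infinitely
many zeros.\<close>

lemma real_polynomial_function_zero:
  fixes f :: "'a::real_normed_vector \<Rightarrow> real"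
  assumes f: "real_polynomial_function f" and zero: "\<And>x. norm x < 1 \<Longrightarrow> f x = 0"
  shows "f x = 0"
proof -
  have lin: "polynomial_function (\<lambda>t::real. t *\<^sub>R x)"
    by (intro polynomial_function_bounded_linear bounded_linear_scaleR_left)
  have "real_polynomial_function (f \<circ> (\<lambda>t. t *\<^sub>R x))"
    using real_polynomial_function_compose[OF lin f] .
  then obtain a n where a: "f \<circ> (\<lambda>t. t *\<^sub>R x) = (\<lambda>t. \<Sum>i\<le>n. a i * t ^ i)"
    unfolding real_polynomial_function_iff_sum by blast
  define p where "p = (\<Sum>i\<le>n. monom (a i) i)"
  have p: "poly p t = f (t *\<^sub>R x)" for t
    using fun_cong[OF a, of t] by (simp add: p_def poly_sum poly_monom)
  have "poly p t = 0" if "t \<in> {0<..<1 / (norm x + 1)}" for t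
  proof -
    have "norm (t *\<^sub>R x) \<le> t * (norm x + 1)"
      using that by (simp add: algebra_simps)
    also have "\<dots> < 1" using that by (simp add: field_simps add_pos_nonneg)
    finally show ?thesis unfolding p by (rule zero)
  qed
  then have "{0<..<1 / (norm x + 1)} \<subseteq> {t. poly p t = 0}" by auto
  moreover have "infinite {0<..<1 / (norm x + 1)}"
    by (simp add: add_nonneg_pos infinite_Ioo)
  ultimately have "p = 0" using poly_roots_finite finite_subset by blast
  then show ?thesis using p[of 1] by simp
qed

lemma real_polynomial_function_unique:
  fixes f g :: "'a::real_normed_vector \<Rightarrow> real"
  assumes "real_polynomial_function f" "real_polynomial_function g"
    and "\<And>x. norm x < 1 \<Longrightarrow> f x = g x"
  shows "f = g"
proof
  fix x show "f x = g x"
    using real_polynomial_function_zero[of "\<lambda>x. f x - g x" x] assms by auto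
qed

lemma cos_angle_exists:
  assumes "norm (y :: real) \<le> 1"
  obtains \<theta> where "y = cos \<theta>"
  using assms cos_arccos[of y] by (metis abs_le_iff minus_le_iff real_norm_def)

text \<open>Every point near the origin has cosines as coordinates. This principle turns trigonometric
identities on the square into identities on the whole plane, and makes the descriptions defining
\<open>Q2\<close> and \<open>K_prod\<close> unique.\<close>

lemma plane_polynomial_eqI:
  fixes f g :: "real \<times> real \<Rightarrow> real"
  assumes "real_polynomial_function f" "real_polynomial_function g"
    and eq: "\<And>\<theta> \<phi>. f (cos \<theta>, cos \<phi>) = g (cos \<theta>, cos \<phi>)"
  shows "f = g"
proof (rule real_polynomial_function_unique[OF assms(1,2)])
  fix x :: "real \<times> real" assume "norm x < 1"
  then have "norm (fst x) \<le> 1" "norm (snd x) \<le> 1"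
    using norm_fst_le[of "fst x" "snd x"] norm_snd_le[of "snd x" "fst x"] by auto
  then obtain \<theta> \<phi> where "x = (cos \<theta>, cos \<phi>)"
    by (metis cos_angle_exists prod.collapse)
  then show "f x = g x" using eq by simp
qed

lemma double_plane_polynomial_eqI:
  fixes f g :: "(real \<times> real) \<times> (real \<times> real) \<Rightarrow> real"
  assumes "real_polynomial_function f" "real_polynomial_function g"
    and eq: "\<And>\<theta>1 \<theta>2 \<phi>1 \<phi>2. f ((cos \<theta>1, cos \<theta>2), (cos \<phi>1, cos \<phi>2)) = g ((cos \<theta>1, cos \<theta>2), (cos \<phi>1, cos \<phi>2))"
  shows "f = g"
proof (rule real_polynomial_function_unique[OF assms(1,2)])
  fix z :: "(real \<times> real) \<times> (real \<times> real)" assume "norm z < 1"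
  then have "norm (fst z) \<le> 1" "norm (snd z) \<le> 1"
    using norm_fst_le[of "fst z" "snd z"] norm_snd_le[of "snd z" "fst z"] by auto
  then have "norm (fst (fst z)) \<le> 1" "norm (snd (fst z)) \<le> 1" "norm (fst (snd z)) \<le> 1" "norm (snd (snd z)) \<le> 1"
    using norm_fst_le[of "fst (fst z)" "snd (fst z)"] norm_snd_le[of "snd (fst z)" "fst (fst z)"]
      norm_fst_le[of "fst (snd z)" "snd (snd z)"] norm_snd_le[of "snd (snd z)" "fst (snd z)"] by auto
  then obtain \<theta>1 \<theta>2 \<phi>1 \<phi>2 where "z = ((cos \<theta>1, cos \<theta>2), (cos \<phi>1, cos \<phi>2))"
    by (metis cos_angle_exists prod.collapse)
  then show "f z = g z" using eq by simp
qed

lemma real_polynomial_function_fst: "real_polynomial_function (\<lambda>x :: real \<times> real. fst x)"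
  and real_polynomial_function_snd: "real_polynomial_function (\<lambda>x :: real \<times> real. snd x)"
  by (intro real_polynomial_function.intros(1) bounded_linear_fst bounded_linear_snd)+

lemmas plane_polynomial_intros =
  real_polynomial_function.intros(2-) real_polynomial_function_fst real_polynomial_function_snd
  real_polynomial_function_diff real_polynomial_function_power real_polynomial_function_sum

text \<open>The power sums \<open>u\<^sup>m + v\<^sup>m\<close> of \<open>u = cos (\<theta> - \<phi>)\<close> and \<open>v = cos (\<theta> + \<phi>)\<close>, by Newton's recursion in
\<open>u + v = 2 x\<^sub>1 x\<^sub>2\<close> and \<open>u v = x\<^sub>1\<^sup>2 + x\<^sub>2\<^sup>2 - 1\<close>.\<close>

fun power_sum_ext :: "nat \<Rightarrow> real \<times> real \<Rightarrow> real" where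
  "power_sum_ext 0 x = 2"
| "power_sum_ext (Suc 0) x = 2 * fst x * snd x"
| "power_sum_ext (Suc (Suc m)) x =
     2 * fst x * snd x * power_sum_ext (Suc m) x - ((fst x)\<^sup>2 + (snd x)\<^sup>2 - 1) * power_sum_ext m x"

text \<open>The plane polynomial extending \<open>u\<^sup>i v\<^sup>j + u\<^sup>j v\<^sup>i\<close>.\<close>

definition sym_monom :: "nat \<Rightarrow> nat \<Rightarrow> real \<times> real \<Rightarrow> real" where
  "sym_monom i j x = ((fst x)\<^sup>2 + (snd x)\<^sup>2 - 1) ^ min i j * power_sum_ext (max i j - min i j) x"

text \<open>The plane polynomial extending \<open>p(u) q(v) + q(u) p(v)\<close>; summing over monomials makes polynomiality
and the bound on the degree visible.\<close>

definition sym_ext :: "real poly \<Rightarrow> real poly \<Rightarrow> real \<times> real \<Rightarrow> real" where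
  "sym_ext p q x = (\<Sum>i\<le>degree p. \<Sum>j\<le>degree q. coeff p i * coeff q j * sym_monom i j x)"

lemma cos_diff_add_cos_add: "cos (\<theta> - \<phi>) + cos (\<theta> + \<phi>) = 2 * cos \<theta> * cos (\<phi>::real)"
  by (simp add: cos_diff cos_add)

lemma cos_diff_mult_cos_add: "cos (\<theta> - \<phi>) * cos (\<theta> + \<phi>) = (cos \<theta>)\<^sup>2 + (cos \<phi>)\<^sup>2 - (1::real)"
proof -
  have "cos (\<theta> - \<phi>) * cos (\<theta> + \<phi>) = (cos \<theta>)\<^sup>2 * (cos \<phi>)\<^sup>2 - (sin \<theta>)\<^sup>2 * (sin \<phi>)\<^sup>2"
    by (simp add: cos_diff cos_add power2_eq_square algebra_simps)
  then show ?thesis by (simp add: sin_squared_eq algebra_simps)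
qed

lemma power_sum_ext_cos:
  "power_sum_ext m (cos \<theta>, cos \<phi>) = cos (\<theta> - \<phi>) ^ m + cos (\<theta> + \<phi>) ^ m"
proof (induction m "(cos \<theta>, cos \<phi>)" rule: power_sum_ext.induct)
  case (3 m)
  have rec: "u ^ Suc (Suc m) + v ^ Suc (Suc m) = (u + v) * (u ^ Suc m + v ^ Suc m) - u * v * (u ^ m + v ^ m)"
    for u v :: real by (simp add: algebra_simps)
  show ?case
    unfolding rec cos_diff_add_cos_add cos_diff_mult_cos_add by (simp add: 3 del: power_Suc)
qed (simp_all add: cos_diff_add_cos_add)

lemma sym_monom_cos:
  "sym_monom i j (cos \<theta>, cos \<phi>) = cos (\<theta> - \<phi>) ^ i * cos (\<theta> + \<phi>) ^ j + cos (\<theta> - \<phi>) ^ j * cos (\<theta> + \<phi>) ^ i"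
proof -
  define u v where "u = cos (\<theta> - \<phi>)" and "v = cos (\<theta> + \<phi>)"
  have *: "u ^ i * v ^ j + u ^ j * v ^ i = (u * v) ^ i * (u ^ (j - i) + v ^ (j - i))" if "i \<le> j" for i j
  proof -
    have "u ^ j = u ^ i * u ^ (j - i)" "v ^ j = v ^ i * v ^ (j - i)"
      using that by (simp_all flip: power_add)
    then show ?thesis by (simp add: algebra_simps)
  qed
  have "sym_monom i j (cos \<theta>, cos \<phi>) = (u * v) ^ min i j * (u ^ (max i j - min i j) + v ^ (max i j - min i j))"
    by (simp add: sym_monom_def power_sum_ext_cos u_def v_def cos_diff_mult_cos_add)
  also have "\<dots> = u ^ i * v ^ j + u ^ j * v ^ i"
    using *[of i j] *[of j i] by (cases "i \<le> j") (auto simp: min_def max_def)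
  finally show ?thesis by (simp add: u_def v_def)
qed

lemma sym_ext_cos:
  "sym_ext p q (cos \<theta>, cos \<phi>) =
     poly p (cos (\<theta> - \<phi>)) * poly q (cos (\<theta> + \<phi>)) + poly q (cos (\<theta> - \<phi>)) * poly p (cos (\<theta> + \<phi>))"
proof -
  define u v where "u = cos (\<theta> - \<phi>)" and "v = cos (\<theta> + \<phi>)"
  have "poly p u * poly q v = (\<Sum>i\<le>degree p. \<Sum>j\<le>degree q. coeff p i * coeff q j * (u ^ i * v ^ j))"
    unfolding poly_altdef sum_product by (simp add: mult_ac)
  moreover have "poly p v * poly q u = (\<Sum>i\<le>degree p. \<Sum>j\<le>degree q. coeff p i * coeff q j * (u ^ j * v ^ i))"
    unfolding poly_altdef sum_product by (simp add: mult_ac)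
  ultimately show ?thesis
    by (simp add: sym_ext_def sym_monom_cos distrib_left sum.distrib u_def v_def mult.commute)
qed

lemma real_polynomial_function_power_sum_ext: "real_polynomial_function (\<lambda>x. power_sum_ext m x)"
  by (induction m rule: induct_nat_012) (auto intro!: plane_polynomial_intros)

lemma real_polynomial_function_sym_ext: "real_polynomial_function (\<lambda>x. sym_ext p q x)"
  unfolding sym_ext_def sym_monom_def
  by (intro plane_polynomial_intros real_polynomial_function_power_sum_ext finite_atMost)

lemmas sym_ext_intros = plane_polynomial_intros real_polynomial_function_sym_ext

lemma sym_ext_commute: "sym_ext p q x = sym_ext q p x"
  by (rule fun_cong[of _ _ x], rule plane_polynomial_eqI)
     (auto intro!: sym_ext_intros simp: sym_ext_cos)

lemma sym_ext_add: "sym_ext (p + r) q x = sym_ext p q x + sym_ext r q x"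
  by (rule fun_cong[of _ _ x], rule plane_polynomial_eqI)
     (auto intro!: sym_ext_intros simp: sym_ext_cos algebra_simps)

lemma sym_ext_smult: "sym_ext (smult c p) q x = c * sym_ext p q x"
  by (rule fun_cong[of _ _ x], rule plane_polynomial_eqI)
     (auto intro!: sym_ext_intros simp: sym_ext_cos algebra_simps)

lemma sym_ext_add_right: "sym_ext p (q + r) x = sym_ext p q x + sym_ext p r x"
  using sym_ext_add sym_ext_commute by metis

lemma sym_ext_smult_right: "sym_ext p (smult c q) x = c * sym_ext p q x"
  using sym_ext_smult sym_ext_commute by metis

lemma sym_ext_0: "sym_ext 0 q x = 0"
  using sym_ext_smult[of 0 0 q x] by simp

lemma sym_ext_sum: "sym_ext (sum f A) q x = (\<Sum>i\<in>A. sym_ext (f i) q x)"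
  by (induction A rule: infinite_finite_induct) (auto simp: sym_ext_0 sym_ext_add)

lemma sym_ext_sum_right: "sym_ext p (sum f A) x = (\<Sum>i\<in>A. sym_ext p (f i) x)"
  using sym_ext_sum[of f A p x] by (simp add: sym_ext_commute)

text \<open>The squares of \<open>x\<^sub>1 + x\<^sub>2\<close> and \<open>x\<^sub>1 - x\<^sub>2\<close> are symmetric in \<open>u\<close> and \<open>v\<close>. This is why the plane
polynomials split into four symmetric parts, according to the parity in these two linear forms.\<close>

lemma square_sum_cos: "(cos \<theta> + cos \<phi>)\<^sup>2 = (1 + cos (\<theta> - \<phi>)) * (1 + cos (\<theta> + \<phi> :: real))"
  using cos_diff_mult_cos_add[of \<theta> \<phi>] cos_diff_add_cos_add[of \<theta> \<phi>]
  by (simp add: power2_eq_square algebra_simps)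

lemma square_diff_cos: "(cos \<theta> - cos \<phi>)\<^sup>2 = (1 - cos (\<theta> - \<phi>)) * (1 - cos (\<theta> + \<phi> :: real))"
  using cos_diff_mult_cos_add[of \<theta> \<phi>] cos_diff_add_cos_add[of \<theta> \<phi>]
  by (simp add: power2_eq_square algebra_simps)

lemma square_sum_sym_ext: "(fst x + snd x)\<^sup>2 * sym_ext p q x = sym_ext ([:1, 1:] * p) ([:1, 1:] * q) x"
  by (rule fun_cong[of _ _ x], rule plane_polynomial_eqI)
     (auto intro!: sym_ext_intros simp: sym_ext_cos square_sum_cos algebra_simps simp del: mult_pCons_left)

lemma square_diff_sym_ext: "(fst x - snd x)\<^sup>2 * sym_ext p q x = sym_ext ([:1, -1:] * p) ([:1, -1:] * q) x"
  by (rule fun_cong[of _ _ x], rule plane_polynomial_eqI)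
     (auto intro!: sym_ext_intros simp: sym_ext_cos square_diff_cos algebra_simps simp del: mult_pCons_left)

lemma Q2_eq:
  "Q2 \<alpha> \<beta> n k x = (if k = n - 1 then sqrt 2 / 2 else 1) * (Q_gamma \<alpha> \<beta> * ((fst x)\<^sup>2 - (snd x)\<^sup>2) *
     sym_ext (jacobi_p (\<alpha> + 1) (\<beta> + 1) (n - 1)) (jacobi_p (\<alpha> + 1) (\<beta> + 1) k) x)"
proof -
  let ?Q = "\<lambda>x. (if k = n - 1 then sqrt 2 / 2 else 1) * (Q_gamma \<alpha> \<beta> * ((fst x)\<^sup>2 - (snd x)\<^sup>2) *
     sym_ext (jacobi_p (\<alpha> + 1) (\<beta> + 1) (n - 1)) (jacobi_p (\<alpha> + 1) (\<beta> + 1) k) x)"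
  have poly: "real_polynomial_function ?Q"
    by (intro sym_ext_intros)
  have "Q2 \<alpha> \<beta> n k = ?Q"
    unfolding Q2_def
  proof (rule the_equality, intro conjI allI)
    show "real_polynomial_function ?Q" by (rule poly)
  next
    fix P assume P: "real_polynomial_function P \<and>
        (\<forall>\<theta> \<phi>. P (cos \<theta>, cos \<phi>) =
           (if k = n - 1 then sqrt 2 / 2 else 1) *
           (Q_gamma \<alpha> \<beta> * ((cos \<theta>)\<^sup>2 - (cos \<phi>)\<^sup>2) *
            (poly (jacobi_p (\<alpha> + 1) (\<beta> + 1) (n - 1)) (cos (\<theta> - \<phi>)) *
             poly (jacobi_p (\<alpha> + 1) (\<beta> + 1) k) (cos (\<theta> + \<phi>)) +
             poly (jacobi_p (\<alpha> + 1) (\<beta> + 1) k) (cos (\<theta> - \<phi>)) *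
             poly (jacobi_p (\<alpha> + 1) (\<beta> + 1) (n - 1)) (cos (\<theta> + \<phi>)))))"
    show "P = ?Q"
      by (rule plane_polynomial_eqI[OF conjunct1[OF P] poly])
         (simp only: conjunct2[OF P, rule_format] sym_ext_cos fst_conv snd_conv)
  qed (simp only: sym_ext_cos fst_conv snd_conv)
  then show ?thesis by simp
qed

text \<open>The symmetrised product of two kernels is a sum of products of symmetric functions of the two
points, which shows that it extends to the plane in both arguments.\<close>

lemma K_prod_eq:
  "K_prod a b m x y = 1/4 * (\<Sum>i<nat (m + 1). \<Sum>j<nat (m + 1).
     sym_ext (jacobi_p a b i) (jacobi_p a b j) x * sym_ext (jacobi_p a b i) (jacobi_p a b j) y)"
proof -
  let ?p = "jacobi_p a b"
  let ?K = "\<lambda>z. 1/4 * (\<Sum>i<nat (m + 1). \<Sum>j<nat (m + 1). sym_ext (?p i) (?p j) (fst z) * sym_ext (?p i) (?p j) (snd z))"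
  have fst: "real_polynomial_function (\<lambda>z :: (real \<times> real) \<times> (real \<times> real). f (fst z))"
    and snd: "real_polynomial_function (\<lambda>z :: (real \<times> real) \<times> (real \<times> real). f (snd z))"
    if "real_polynomial_function f" for f
    using real_polynomial_function_compose[OF polynomial_function_bounded_linear[OF bounded_linear_fst] that]
      real_polynomial_function_compose[OF polynomial_function_bounded_linear[OF bounded_linear_snd] that]
    by (simp_all add: o_def)
  have poly: "real_polynomial_function ?K"
    by (intro plane_polynomial_intros fst[of "\<lambda>x. sym_ext _ _ x"] snd[of "\<lambda>x. sym_ext _ _ x"]
        real_polynomial_function_sym_ext finite_lessThan)
  have on_cosines: "?K ((cos \<theta>1, cos \<theta>2), (cos \<phi>1, cos \<phi>2)) =
           1/2 * (jacobi_k a b m (cos (\<theta>1 - \<theta>2)) (cos (\<phi>1 - \<phi>2)) *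
                  jacobi_k a b m (cos (\<theta>1 + \<theta>2)) (cos (\<phi>1 + \<phi>2)) +
                  jacobi_k a b m (cos (\<theta>1 - \<theta>2)) (cos (\<phi>1 + \<phi>2)) *
                  jacobi_k a b m (cos (\<theta>1 + \<theta>2)) (cos (\<phi>1 - \<phi>2)))" for \<theta>1 \<theta>2 \<phi>1 \<phi>2
  proof -
    define N u v u' v' where "N = nat (m + 1)" and "u = cos (\<theta>1 - \<theta>2)" and "v = cos (\<theta>1 + \<theta>2)"
      and "u' = cos (\<phi>1 - \<phi>2)" and "v' = cos (\<phi>1 + \<phi>2)"
    have prod: "jacobi_k a b m r r' * jacobi_k a b m t t' =
        (\<Sum>i<N. \<Sum>j<N. poly (?p i) r * poly (?p i) r' * (poly (?p j) t * poly (?p j) t'))" for r r' t t'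
      by (simp add: jacobi_k_def sum_product N_def)
    have sums: "(\<Sum>i<N. \<Sum>j<N. (f i j + g i j) :: real) = (\<Sum>i<N. \<Sum>j<N. f i j) + (\<Sum>i<N. \<Sum>j<N. g i j)" for f g
      by (simp add: sum.distrib)
    have "(\<Sum>i<N. \<Sum>j<N. sym_ext (?p i) (?p j) (cos \<theta>1, cos \<theta>2) * sym_ext (?p i) (?p j) (cos \<phi>1, cos \<phi>2)) =
       (\<Sum>i<N. \<Sum>j<N. poly (?p i) u * poly (?p i) u' * (poly (?p j) v * poly (?p j) v')) +
       (\<Sum>i<N. \<Sum>j<N. poly (?p i) u * poly (?p i) v' * (poly (?p j) v * poly (?p j) u')) +
       (\<Sum>i<N. \<Sum>j<N. poly (?p i) v * poly (?p i) u' * (poly (?p j) u * poly (?p j) v')) +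
       (\<Sum>i<N. \<Sum>j<N. poly (?p i) v * poly (?p i) v' * (poly (?p j) u * poly (?p j) u'))"
      unfolding sums[symmetric] sym_ext_cos u_def[symmetric] v_def[symmetric] u'_def[symmetric] v'_def[symmetric]
      by (intro sum.cong refl) algebra
    then show ?thesis
      unfolding prod[symmetric] N_def[symmetric] u_def[symmetric] v_def[symmetric] u'_def[symmetric] v'_def[symmetric]
      by (simp add: mult.commute)
  qed
  have "K_prod a b m x y = ?K (x, y)"
    unfolding K_prod_def
  proof (rule fun_cong[of _ _ "(x, y)"], rule the_equality, intro conjI allI)
    show "real_polynomial_function ?K" by (rule poly)
  next
    fix P :: "(real \<times> real) \<times> (real \<times> real) \<Rightarrow> real"
    assume P: "real_polynomial_function P \<and>
        (\<forall>\<theta>1 \<theta>2 \<phi>1 \<phi>2. P ((cos \<theta>1, cos \<theta>2), (cos \<phi>1, cos \<phi>2)) =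
           1/2 * (jacobi_k a b m (cos (\<theta>1 - \<theta>2)) (cos (\<phi>1 - \<phi>2)) *
                  jacobi_k a b m (cos (\<theta>1 + \<theta>2)) (cos (\<phi>1 + \<phi>2)) +
                  jacobi_k a b m (cos (\<theta>1 - \<theta>2)) (cos (\<phi>1 + \<phi>2)) *
                  jacobi_k a b m (cos (\<theta>1 + \<theta>2)) (cos (\<phi>1 - \<phi>2))))"
    show "P = ?K"
      by (rule double_plane_polynomial_eqI[OF conjunct1[OF P] poly])
         (simp only: conjunct2[OF P, rule_format] on_cosines)
  qed (rule on_cosines)
  then show ?thesis by simp
qed

text \<open>With the second point given by angles, the kernel is again a symmetrised product of two
univariate polynomials; this is the form in which the univariate identities at the nodes apply.\<close>

lemma K_prod_eq_sym_ext_kernel_poly: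
  "K_prod a b (int m - 1) x (cos \<phi>1, cos \<phi>2) =
     1/2 * sym_ext (kernel_poly a b m (cos (\<phi>1 - \<phi>2))) (kernel_poly a b m (cos (\<phi>1 + \<phi>2))) x"
proof -
  let ?p = "jacobi_p a b"
  define u v where "u = cos (\<phi>1 - \<phi>2)" and "v = cos (\<phi>1 + \<phi>2)"
  define S where "S = (\<Sum>i<m. \<Sum>j<m. poly (?p i) u * poly (?p j) v * sym_ext (?p i) (?p j) x)"
  have "sym_ext (kernel_poly a b m u) (kernel_poly a b m v) x = S"
    unfolding S_def kernel_poly_def sym_ext_sum sym_ext_smult
    by (simp add: sym_ext_sum_right sym_ext_smult_right sum_distrib_left mult_ac)
  moreover have "S = (\<Sum>i<m. \<Sum>j<m. poly (?p j) u * poly (?p i) v * sym_ext (?p i) (?p j) x)"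
    unfolding S_def by (rule trans[OF sum.swap]) (intro sum.cong refl arg_cong2[of _ _ _ _ times] sym_ext_commute)
  then have "(\<Sum>i<m. \<Sum>j<m. sym_ext (?p i) (?p j) x * sym_ext (?p i) (?p j) (cos \<phi>1, cos \<phi>2)) = S + S"
    unfolding sym_ext_cos u_def[symmetric] v_def[symmetric]
    by (subst (1) S_def) (simp add: algebra_simps sum.distrib)
  ultimately show ?thesis
    by (simp add: K_prod_eq u_def v_def)
qed

section \<open>The spaces of interpolating polynomials\<close>

lemma Pi2_monom: "i + j \<le> m \<Longrightarrow> (\<lambda>x. a * fst x ^ i * snd x ^ j) \<in> Pi2 m"
proof -
  assume ij: "i + j \<le> m"
  define c where "c i' j' = (if i' = i then (if j' = j then a else 0) else 0)" for i' j'
  have "(\<Sum>i'\<le>m. \<Sum>j'\<le>m - i'. c i' j' * x ^ i' * y ^ j') = a * x ^ i * y ^ j" for x y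
  proof -
    have "c i' j' * x ^ i' * y ^ j' = (if j' = j then if i' = i then a * x ^ i * y ^ j else 0 else 0)" for i' j'
      by (simp add: c_def)
    then have "(\<Sum>i'\<le>m. \<Sum>j'\<le>m - i'. c i' j' * x ^ i' * y ^ j')
        = (\<Sum>i'\<le>m. if i' = i then a * x ^ i * y ^ j else 0)"
      using ij by (intro sum.cong) auto
    then show ?thesis using ij by simp
  qed
  then show ?thesis
    unfolding Pi2_def by (intro CollectI exI[of _ c]) (auto simp: fun_eq_iff)
qed

lemma Pi2_zero: "(\<lambda>x. 0) \<in> Pi2 m"
  using Pi2_monom[of 0 0 m 0] by simp

lemma Pi2_add: "f \<in> Pi2 m \<Longrightarrow> g \<in> Pi2 m \<Longrightarrow> (\<lambda>x. f x + g x) \<in> Pi2 m"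
proof -
  assume "f \<in> Pi2 m" "g \<in> Pi2 m"
  then obtain c d where
    "f = (\<lambda>(x, y). \<Sum>i\<le>m. \<Sum>j\<le>m - i. c i j * x ^ i * y ^ j)"
    "g = (\<lambda>(x, y). \<Sum>i\<le>m. \<Sum>j\<le>m - i. d i j * x ^ i * y ^ j)"
    unfolding Pi2_def by blast
  then have "(\<lambda>x. f x + g x) = (\<lambda>(x, y). \<Sum>i\<le>m. \<Sum>j\<le>m - i. (c i j + d i j) * x ^ i * y ^ j)"
    by (simp add: fun_eq_iff sum.distrib distrib_right)
  then show ?thesis unfolding Pi2_def by (intro CollectI exI[of _ "\<lambda>i j. c i j + d i j"])
qed

lemma Pi2_sum: "(\<And>i. i \<in> A \<Longrightarrow> f i \<in> Pi2 m) \<Longrightarrow> (\<lambda>x. \<Sum>i\<in>A. f i x) \<in> Pi2 m"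
  by (induction A rule: infinite_finite_induct) (auto intro: Pi2_zero Pi2_add)

text \<open>Closure properties of \<open>Pi2\<close> are thereby reduced to monomials.\<close>

lemma Pi2_induct [consumes 1, case_names zero add monom]:
  assumes "f \<in> Pi2 m"
    and zero: "P (\<lambda>x. 0)"
    and add: "\<And>f g. P f \<Longrightarrow> P g \<Longrightarrow> P (\<lambda>x. f x + g x)"
    and monom: "\<And>a i j. i + j \<le> m \<Longrightarrow> P (\<lambda>x. a * fst x ^ i * snd x ^ j)"
  shows "P f"
proof -
  obtain c where "f = (\<lambda>(x, y). \<Sum>i\<le>m. \<Sum>j\<le>m - i. c i j * x ^ i * y ^ j)"
    using assms(1) unfolding Pi2_def by blast
  then have f: "f = (\<lambda>x. \<Sum>i\<le>m. \<Sum>j\<le>m - i. c i j * fst x ^ i * snd x ^ j)"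
    by (simp add: fun_eq_iff)
  have sum: "P (\<lambda>x. \<Sum>i\<in>A. g i x)" if "finite A" "\<And>i. i \<in> A \<Longrightarrow> P (g i)" for A :: "nat set" and g
    using that by (induction A rule: finite_induct) (auto intro: zero add)
  show ?thesis
    unfolding f by (intro sum monom) auto
qed

lemma Pi2_mult_left: "f \<in> Pi2 m \<Longrightarrow> (\<lambda>x. c * f x) \<in> Pi2 m"
proof (induction rule: Pi2_induct)
  case (monom a i j)
  then show ?case using Pi2_monom[of i j m "c * a"] by (simp add: mult.assoc)
qed (auto simp: distrib_left intro: Pi2_zero Pi2_add)

lemma Pi2_diff: "f \<in> Pi2 m \<Longrightarrow> g \<in> Pi2 m \<Longrightarrow> (\<lambda>x. f x - g x) \<in> Pi2 m"
  using Pi2_add[OF _ Pi2_mult_left[of g m "-1"], of f] by simp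

lemma Pi2_mono: "f \<in> Pi2 m \<Longrightarrow> m \<le> m' \<Longrightarrow> f \<in> Pi2 m'"
  by (induction rule: Pi2_induct) (auto intro: Pi2_zero Pi2_add Pi2_monom)

lemma Pi2_mult_fst: "f \<in> Pi2 m \<Longrightarrow> (\<lambda>x. fst x * f x) \<in> Pi2 (Suc m)"
proof (induction rule: Pi2_induct)
  case (monom a i j)
  then show ?case using Pi2_monom[of "Suc i" j "Suc m" a] by (simp add: mult_ac)
qed (auto simp: distrib_left intro: Pi2_zero Pi2_add)

lemma Pi2_mult_snd: "f \<in> Pi2 m \<Longrightarrow> (\<lambda>x. snd x * f x) \<in> Pi2 (Suc m)"
proof (induction rule: Pi2_induct)
  case (monom a i j)
  then show ?case using Pi2_monom[of i "Suc j" "Suc m" a] by (simp add: mult_ac)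
qed (auto simp: distrib_left intro: Pi2_zero Pi2_add)

lemma Pi2_mult_sum_coord: "f \<in> Pi2 m \<Longrightarrow> (\<lambda>x. (fst x + snd x) * f x) \<in> Pi2 (Suc m)"
  unfolding distrib_right by (intro Pi2_add Pi2_mult_fst Pi2_mult_snd)

lemma Pi2_mult_diff_coord: "f \<in> Pi2 m \<Longrightarrow> (\<lambda>x. (fst x - snd x) * f x) \<in> Pi2 (Suc m)"
  unfolding left_diff_distrib by (intro Pi2_diff Pi2_mult_fst Pi2_mult_snd)

lemma Pi2_mult_uv:
  assumes "f \<in> Pi2 m"
  shows "(\<lambda>x. ((fst x)\<^sup>2 + (snd x)\<^sup>2 - 1) * f x) \<in> Pi2 (m + 2)"
proof -
  have "(\<lambda>x. fst x * (fst x * f x) + snd x * (snd x * f x) - f x) \<in> Pi2 (Suc (Suc m))"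
    using assms Pi2_mono[OF assms, of "Suc (Suc m)"]
    by (intro Pi2_diff[OF Pi2_add] Pi2_mult_fst Pi2_mult_snd) auto
  then show ?thesis by (simp add: power2_eq_square algebra_simps)
qed

lemma Pi2_power_sum_ext: "(\<lambda>x. power_sum_ext m x) \<in> Pi2 (2 * m)"
proof (induction m rule: induct_nat_012)
  case 0
  show ?case using Pi2_monom[of 0 0 0 2] by simp
next
  case 1
  show ?case using Pi2_monom[of 1 1 2 2] by simp
next
  case (ge2 m)
  have "(\<lambda>x. 2 * (fst x * (snd x * power_sum_ext (Suc m) x))) \<in> Pi2 (Suc (Suc (2 * Suc m)))"
    by (intro Pi2_mult_left Pi2_mult_fst Pi2_mult_snd ge2)
  moreover have "(\<lambda>x. ((fst x)\<^sup>2 + (snd x)\<^sup>2 - 1) * power_sum_ext m x) \<in> Pi2 (2 * m + 2)"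
    by (intro Pi2_mult_uv ge2)
  then have "(\<lambda>x. ((fst x)\<^sup>2 + (snd x)\<^sup>2 - 1) * power_sum_ext m x) \<in> Pi2 (Suc (Suc (2 * Suc m)))"
    by (rule Pi2_mono) simp
  ultimately have "(\<lambda>x. 2 * (fst x * (snd x * power_sum_ext (Suc m) x))
      - ((fst x)\<^sup>2 + (snd x)\<^sup>2 - 1) * power_sum_ext m x) \<in> Pi2 (Suc (Suc (2 * Suc m)))"
    by (rule Pi2_diff)
  then show ?case by (simp add: mult.assoc)
qed

lemma Pi2_sym_monom:
  assumes "i \<le> d" "j \<le> d"
  shows "(\<lambda>x. sym_monom i j x) \<in> Pi2 (2 * d)"
proof -
  have "(\<lambda>x. ((fst x)\<^sup>2 + (snd x)\<^sup>2 - 1) ^ k * power_sum_ext m x) \<in> Pi2 (2 * m + 2 * k)" for k m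
  proof (induction k)
    case (Suc k)
    from Pi2_mult_uv[OF this] show ?case by (simp add: mult.assoc)
  qed (simp add: Pi2_power_sum_ext)
  then show ?thesis
    unfolding sym_monom_def by (rule Pi2_mono) (use assms in auto)
qed

lemma Pi2_sym_ext:
  assumes "degree p \<le> d" "degree q \<le> d"
  shows "(\<lambda>x. sym_ext p q x) \<in> Pi2 (2 * d)"
  unfolding sym_ext_def by (intro Pi2_sum Pi2_mult_left Pi2_sym_monom) (use assms in auto)

text \<open>The span of the products \<open>(x\<^sub>1 + x\<^sub>2)\<^sup>\<sigma> (x\<^sub>1 - x\<^sub>2)\<^sup>\<tau>\<close> times a symmetric part, with \<open>\<sigma>, \<tau> \<le> 1\<close>, graded
by total degree: a symmetric function of degree \<open>d\<close> in each of \<open>u\<close> and \<open>v\<close> has degree at most \<open>2 d\<close> in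
the plane.\<close>

inductive_set sym_hull :: "nat \<Rightarrow> (real \<times> real \<Rightarrow> real) set" for m where
  zero: "(\<lambda>x. 0) \<in> sym_hull m"
| add: "f \<in> sym_hull m \<Longrightarrow> g \<in> sym_hull m \<Longrightarrow> (\<lambda>x. f x + g x) \<in> sym_hull m"
| gen: "\<sigma> \<le> 1 \<Longrightarrow> \<tau> \<le> 1 \<Longrightarrow> degree p \<le> d \<Longrightarrow> degree q \<le> d \<Longrightarrow> \<sigma> + \<tau> + 2 * d \<le> m \<Longrightarrow>
    (\<lambda>x. c * ((fst x + snd x) ^ \<sigma> * (fst x - snd x) ^ \<tau> * sym_ext p q x)) \<in> sym_hull m"

lemma sym_hull_mono: "f \<in> sym_hull m \<Longrightarrow> m \<le> m' \<Longrightarrow> f \<in> sym_hull m'"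
  by (induction rule: sym_hull.induct) (auto intro: sym_hull.intros)

lemma sym_hull_mult_left: "f \<in> sym_hull m \<Longrightarrow> (\<lambda>x. a * f x) \<in> sym_hull m"
proof (induction rule: sym_hull.induct)
  case (gen \<sigma> \<tau> p d q c)
  then show ?case using sym_hull.gen[of \<sigma> \<tau> p d q m "a * c"] by (simp add: mult.assoc)
qed (auto simp: distrib_left intro: sym_hull.intros)

text \<open>A second factor \<open>x\<^sub>1 + x\<^sub>2\<close> is absorbed into the symmetric part, as its square is \<open>(1 + u) (1 + v)\<close>.\<close>

lemma sym_hull_mult_sum_coord: "f \<in> sym_hull m \<Longrightarrow> (\<lambda>x. (fst x + snd x) * f x) \<in> sym_hull (Suc m)"
proof (induction rule: sym_hull.induct)
  case (gen \<sigma> \<tau> p d q c)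
  show ?case
  proof (cases "\<sigma> = 0")
    case True
    then show ?thesis using sym_hull.gen[of 1 \<tau> p d q "Suc m" c] gen by (simp add: mult_ac)
  next
    case False
    then have "\<sigma> = 1" using gen by simp
    have "degree ([:1, 1:] * p) \<le> Suc d" "degree ([:1, 1:] * q) \<le> Suc d"
      using gen by (auto intro!: order.trans[OF degree_mult_le] simp del: mult_pCons_left)
    then have "(\<lambda>x. c * ((fst x + snd x) ^ 0 * (fst x - snd x) ^ \<tau> * sym_ext ([:1, 1:] * p) ([:1, 1:] * q) x)) \<in> sym_hull (Suc m)"
      using gen \<open>\<sigma> = 1\<close> by (intro sym_hull.gen) auto
    then show ?thesis
      unfolding square_sum_sym_ext[symmetric] using \<open>\<sigma> = 1\<close> by (simp add: power2_eq_square mult_ac)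
  qed
qed (auto simp: distrib_left intro: sym_hull.intros)

lemma sym_hull_mult_diff_coord: "f \<in> sym_hull m \<Longrightarrow> (\<lambda>x. (fst x - snd x) * f x) \<in> sym_hull (Suc m)"
proof (induction rule: sym_hull.induct)
  case (gen \<sigma> \<tau> p d q c)
  show ?case
  proof (cases "\<tau> = 0")
    case True
    then show ?thesis using sym_hull.gen[of \<sigma> 1 p d q "Suc m" c] gen by (simp add: mult_ac)
  next
    case False
    then have "\<tau> = 1" using gen by simp
    have "degree ([:1, -1:] * p) \<le> Suc d" "degree ([:1, -1:] * q) \<le> Suc d"
      using gen by (auto intro!: order.trans[OF degree_mult_le] simp del: mult_pCons_left)
    then have "(\<lambda>x. c * ((fst x + snd x) ^ \<sigma> * (fst x - snd x) ^ 0 * sym_ext ([:1, -1:] * p) ([:1, -1:] * q) x)) \<in> sym_hull (Suc m)"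
      using gen \<open>\<tau> = 1\<close> by (intro sym_hull.gen) auto
    then show ?thesis
      unfolding square_diff_sym_ext[symmetric] using \<open>\<tau> = 1\<close> by (simp add: power2_eq_square mult_ac)
  qed
qed (auto simp: distrib_left intro: sym_hull.intros)

lemma sym_hull_mult_fst:
  assumes "f \<in> sym_hull m"
  shows "(\<lambda>x. fst x * f x) \<in> sym_hull (Suc m)"
proof -
  have "(\<lambda>x. 1/2 * ((fst x + snd x) * f x + (fst x - snd x) * f x)) \<in> sym_hull (Suc m)"
    using assms by (intro sym_hull_mult_left sym_hull.add sym_hull_mult_sum_coord sym_hull_mult_diff_coord)
  then show ?thesis by (simp add: algebra_simps)
qed

lemma sym_hull_mult_snd:
  assumes "f \<in> sym_hull m"
  shows "(\<lambda>x. snd x * f x) \<in> sym_hull (Suc m)"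
proof -
  have "(\<lambda>x. 1/2 * ((fst x + snd x) * f x + (-1) * ((fst x - snd x) * f x))) \<in> sym_hull (Suc m)"
    using assms by (intro sym_hull_mult_left sym_hull.add sym_hull_mult_sum_coord sym_hull_mult_diff_coord)
  then show ?thesis by (simp add: algebra_simps)
qed

text \<open>The coordinates are half the sum and half the difference of the two linear forms, so monomials are
built up by multiplications that stay in the hull.\<close>

lemma Pi2_subset_sym_hull: "f \<in> Pi2 m \<Longrightarrow> f \<in> sym_hull m"
proof (induction rule: Pi2_induct)
  case (monom a i j)
  have one: "(\<lambda>x. 1) \<in> sym_hull 0"
    using sym_hull.gen[of 0 0 1 0 1 0 "1/2"] by (simp add: sym_ext_def sym_monom_def)
  have snd: "(\<lambda>x. snd x ^ j) \<in> sym_hull j"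
    by (induction j) (auto intro: one dest: sym_hull_mult_snd)
  have "(\<lambda>x. fst x ^ i * snd x ^ j) \<in> sym_hull (i + j)"
  proof (induction i)
    case (Suc i)
    from sym_hull_mult_fst[OF this] show ?case by (simp add: mult.assoc)
  qed (simp add: snd)
  from sym_hull_mono[OF sym_hull_mult_left[OF this, of a] monom]
  show ?case by (simp add: mult.assoc)
qed (auto intro: sym_hull.intros)

lemma Pi_star_Pi2: "f \<in> Pi2 (2 * n - 1) \<Longrightarrow> f \<in> Pi_star \<alpha> \<beta> n"
  unfolding Pi_star_def by (intro CollectI exI[of _ f] exI[of _ "\<lambda>_. 0"]) simp

lemma Pi_star_Q2: "k < n \<Longrightarrow> (\<lambda>x. c * Q2 \<alpha> \<beta> n k x) \<in> Pi_star \<alpha> \<beta> n"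
  unfolding Pi_star_def
  by (intro CollectI exI[of _ "\<lambda>_. 0"] exI[of _ "\<lambda>j. if j = k then c else 0"])
     (simp add: Pi2_zero fun_eq_iff mult_delta_left)

lemma Pi_star_add:
  assumes "f \<in> Pi_star \<alpha> \<beta> n" "g \<in> Pi_star \<alpha> \<beta> n"
  shows "(\<lambda>x. f x + g x) \<in> Pi_star \<alpha> \<beta> n"
proof -
  obtain P b Q c where
    "P \<in> Pi2 (2 * n - 1)" "f = (\<lambda>x. P x + (\<Sum>k<n. b k * Q2 \<alpha> \<beta> n k x))"
    "Q \<in> Pi2 (2 * n - 1)" "g = (\<lambda>x. Q x + (\<Sum>k<n. c k * Q2 \<alpha> \<beta> n k x))"
    using assms unfolding Pi_star_def by blast
  then show ?thesis
    unfolding Pi_star_def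
    by (intro CollectI exI[of _ "\<lambda>x. P x + Q x"] exI[of _ "\<lambda>k. b k + c k"])
       (simp add: Pi2_add fun_eq_iff sum.distrib distrib_right)
qed

lemma Pi_star_mult_left:
  assumes "f \<in> Pi_star \<alpha> \<beta> n"
  shows "(\<lambda>x. a * f x) \<in> Pi_star \<alpha> \<beta> n"
proof -
  obtain P b where
    "P \<in> Pi2 (2 * n - 1)" "f = (\<lambda>x. P x + (\<Sum>k<n. b k * Q2 \<alpha> \<beta> n k x))"
    using assms unfolding Pi_star_def by blast
  then show ?thesis
    unfolding Pi_star_def
    by (intro CollectI exI[of _ "\<lambda>x. a * P x"] exI[of _ "\<lambda>k. a * b k"])
       (simp add: Pi2_mult_left fun_eq_iff sum_distrib_left distrib_left mult.assoc)
qed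

lemma Pi_star_sum:
  "(\<And>i. i \<in> A \<Longrightarrow> f i \<in> Pi_star \<alpha> \<beta> n) \<Longrightarrow> (\<lambda>x. \<Sum>i\<in>A. f i x) \<in> Pi_star \<alpha> \<beta> n"
  by (induction A rule: infinite_finite_induct) (auto intro: Pi_star_Pi2 Pi2_zero Pi_star_add)

lemma Pi_star_sym_ext:
  assumes "degree p < n" "degree q < n"
  shows "(\<lambda>x. sym_ext p q x) \<in> Pi_star \<alpha> \<beta> n"
    and "(\<lambda>x. (fst x + snd x) * sym_ext p q x) \<in> Pi_star \<alpha> \<beta> n"
    and "(\<lambda>x. (fst x - snd x) * sym_ext p q x) \<in> Pi_star \<alpha> \<beta> n"
proof -
  have *: "(\<lambda>x. sym_ext p q x) \<in> Pi2 (2 * (n - 1))"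
    using assms by (intro Pi2_sym_ext) auto
  have e: "2 * (n - 1) \<le> 2 * n - 1" "Suc (2 * (n - 1)) \<le> 2 * n - 1" using assms by auto
  show "(\<lambda>x. sym_ext p q x) \<in> Pi_star \<alpha> \<beta> n"
    by (intro Pi_star_Pi2 Pi2_mono[OF *] e)
  show "(\<lambda>x. (fst x + snd x) * sym_ext p q x) \<in> Pi_star \<alpha> \<beta> n"
    by (intro Pi_star_Pi2 Pi2_mono[OF Pi2_mult_sum_coord[OF *]] e)
  show "(\<lambda>x. (fst x - snd x) * sym_ext p q x) \<in> Pi_star \<alpha> \<beta> n"
    by (intro Pi_star_Pi2 Pi2_mono[OF Pi2_mult_diff_coord[OF *]] e)
qed

text \<open>Here the degree can reach \<open>2n\<close>. Expanded in the orthonormal basis, the products without an index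
\<open>n - 1\<close> have degree at most \<open>2n - 2\<close>, and each of the others is a multiple of some \<open>Q2\<close>.\<close>

lemma Pi_star_sum_diff_sym_ext:
  assumes ab: "\<alpha> > -1" "\<beta> > -1" and "degree p < n" "degree q < n"
  shows "(\<lambda>x. (fst x + snd x) * (fst x - snd x) * sym_ext p q x) \<in> Pi_star \<alpha> \<beta> n"
proof -
  define P where "P = jacobi_p (\<alpha> + 1) (\<beta> + 1)"
  have ab1: "\<alpha> + 1 > -1" "\<beta> + 1 > -1" using ab by auto
  have P: "degree (P i) = i" "P i \<noteq> 0" for i using ab1 by (auto simp: P_def)
  define \<gamma> where "\<gamma> = Q_gamma \<alpha> \<beta>"
  have \<gamma>: "\<gamma> \<noteq> 0"
    using jacobi_c_pos[OF ab] jacobi_c_pos[OF ab1] by (simp add: \<gamma>_def Q_gamma_def)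
  have top: "(\<lambda>x. (fst x + snd x) * (fst x - snd x) * sym_ext (P (n - 1)) (P k) x) \<in> Pi_star \<alpha> \<beta> n" if "k < n" for k
  proof -
    have "(\<lambda>x. (if k = n - 1 then sqrt 2 else 1) / \<gamma> * Q2 \<alpha> \<beta> n k x) =
      (\<lambda>x. (fst x + snd x) * (fst x - snd x) * sym_ext (P (n - 1)) (P k) x)"
    proof (rule ext)
      fix x :: "real \<times> real"
      have "(if k = n - 1 then sqrt 2 else 1) / \<gamma> * Q2 \<alpha> \<beta> n k x =
          ((fst x)\<^sup>2 - (snd x)\<^sup>2) * sym_ext (P (n - 1)) (P k) x"
        using \<gamma> by (simp add: Q2_eq \<gamma>_def P_def)
      then show "(if k = n - 1 then sqrt 2 else 1) / \<gamma> * Q2 \<alpha> \<beta> n k x =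
          (fst x + snd x) * (fst x - snd x) * sym_ext (P (n - 1)) (P k) x"
        by (simp only: square_diff_square_factored power2_eq_square)
    qed
    with Pi_star_Q2[OF that, of "(if k = n - 1 then sqrt 2 else 1) / \<gamma>" \<alpha> \<beta>] show ?thesis
      by (simp only:)
  qed
  have basis: "(\<lambda>x. (fst x + snd x) * (fst x - snd x) * sym_ext (P i) (P j) x) \<in> Pi_star \<alpha> \<beta> n" if "i < n" "j < n" for i j
  proof (cases "i = n - 1 \<or> j = n - 1")
    case True
    then show ?thesis
      using top[OF that(1)] top[OF that(2)]
        sym_ext_commute[of "P i" "P j"] by (elim disjE) (simp_all only:)
  next
    case False
    have *: "(\<lambda>x. sym_ext (P i) (P j) x) \<in> Pi2 (2 * (n - 2))"
      using False that by (intro Pi2_sym_ext) (auto simp: P)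
    have "(\<lambda>x. (fst x + snd x) * ((fst x - snd x) * sym_ext (P i) (P j) x)) \<in> Pi_star \<alpha> \<beta> n"
      by (intro Pi_star_Pi2 Pi2_mono[OF Pi2_mult_sum_coord[OF Pi2_mult_diff_coord[OF *]]])
         (use False that in auto)
    then show ?thesis by (simp add: mult.assoc)
  qed
  obtain a b where a: "p = (\<Sum>i<n. smult (a i) (P i))" and b: "q = (\<Sum>i<n. smult (b i) (P i))"
    using graded_basis_expansion[of P n p, OF P] graded_basis_expansion[of P n q, OF P] assms
    by (meson coeff_eq_0 less_le_trans)
  have "(\<lambda>x. (fst x + snd x) * (fst x - snd x) * sym_ext p q x) =
    (\<lambda>x. \<Sum>i<n. \<Sum>j<n. (a i * b j) * ((fst x + snd x) * (fst x - snd x) * sym_ext (P i) (P j) x))"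
    unfolding a b sym_ext_sum sym_ext_smult
    by (simp add: sym_ext_sum_right sym_ext_smult_right sum_distrib_left mult_ac)
  also have "\<dots> \<in> Pi_star \<alpha> \<beta> n"
    by (intro Pi_star_sum Pi_star_mult_left basis) auto
  finally show ?thesis .
qed

section \<open>Interpolation at the cubature nodes\<close>

lemma kernel_poly_Suc:
  "kernel_poly a b (Suc m) y = kernel_poly a b m y + smult (poly (jacobi_p a b m) y) (jacobi_p a b m)"
  by (simp add: kernel_poly_def)

text \<open>Halving the diagonal turns a sum over \<open>j \<le> k\<close> into half the sum over the full square.\<close>

lemma sum_triangle_symmetric:
  fixes F :: "nat \<Rightarrow> nat \<Rightarrow> real"
  assumes "\<And>j k. F j k = F k j"
  shows "(\<Sum>k=1..n. \<Sum>j=1..k. (if j = k then 1/2 else 1) * F j k) = 1/2 * (\<Sum>k=1..n. \<Sum>j=1..n. F j k)"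
proof (induction n)
  case (Suc n)
  have "(\<Sum>j=1..Suc n. (if j = Suc n then 1/2 else 1) * F j (Suc n)) = (\<Sum>j=1..n. F j (Suc n)) + 1/2 * F (Suc n) (Suc n)"
    by (simp add: sum.atLeast_Suc_atMost)
  moreover have "(\<Sum>k=1..Suc n. \<Sum>j=1..Suc n. F j k) =
      (\<Sum>k=1..n. \<Sum>j=1..n. F j k) + (\<Sum>k=1..n. F (Suc n) k) + (\<Sum>j=1..n. F j (Suc n)) + F (Suc n) (Suc n)"
    by (simp add: sum.distrib)
  moreover have "(\<Sum>k=1..n. F (Suc n) k) = (\<Sum>j=1..n. F j (Suc n))"
    by (intro sum.cong refl assms)
  ultimately show ?case using Suc.IH by simp
qed simp

context jacobi_nodes
begin

text \<open>The two linear forms at a node. Up to sign they depend on the unordered pair \<open>{j, k}\<close> only, and the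
four nodes of that pair realise the four combinations of signs.\<close>

definition node_sum :: "nat \<Rightarrow> nat \<Rightarrow> nat \<Rightarrow> real" where
  "node_sum i j k = fst (cub_node \<theta> i j k) + snd (cub_node \<theta> i j k)"

definition node_diff :: "nat \<Rightarrow> nat \<Rightarrow> nat \<Rightarrow> real" where
  "node_diff i j k = fst (cub_node \<theta> i j k) - snd (cub_node \<theta> i j k)"

text \<open>Each node is a point of the square with angles for which \<open>u = X k\<close> and \<open>v = X j\<close>; negating both
coordinates amounts to shifting both angles by \<open>pi\<close>.\<close>

lemma cub_node_angles:
  obtains \<phi>1 \<phi>2 where "cub_node \<theta> i j k = (cos \<phi>1, cos \<phi>2)"
    "cos (\<phi>1 - \<phi>2) = X k" "cos (\<phi>1 + \<phi>2) = X j"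
proof -
  define a b where "a = (\<theta> j - \<theta> k) / 2" and "b = (\<theta> j + \<theta> k) / 2"
  have ab: "a - b = - \<theta> k" "a + b = \<theta> j" "b - a = \<theta> k" "b + a = \<theta> j"
    by (simp_all add: a_def b_def field_simps)
  have c: "cos (a - b) = X k" "cos (a + b) = X j" "cos (b - a) = X k" "cos (b + a) = X j"
    unfolding ab by simp_all
  have shift: "cos ((x + pi) - (y + pi)) = cos (x - y)" "cos ((x + pi) + (y + pi)) = cos (x + y)" for x y :: real
    using cos_periodic[of "x + y"] by (simp_all add: algebra_simps)
  have "cub_node \<theta> i j k \<in> {(cos a, cos b), (cos b, cos a), (cos (a + pi), cos (b + pi)), (cos (b + pi), cos (a + pi))}"
    by (simp add: cub_node_def Let_def a_def b_def)
  then consider "cub_node \<theta> i j k = (cos a, cos b)" | "cub_node \<theta> i j k = (cos b, cos a)"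
    | "cub_node \<theta> i j k = (cos (a + pi), cos (b + pi))" | "cub_node \<theta> i j k = (cos (b + pi), cos (a + pi))"
    by blast
  then show thesis
  proof cases
    case 1
    then show thesis using that[of a b] c by simp
  next
    case 2
    then show thesis using that[of b a] c by simp
  next
    case 3
    then show thesis using that[of "a + pi" "b + pi"] c unfolding shift by simp
  next
    case 4
    then show thesis using that[of "b + pi" "a + pi"] c unfolding shift by simp
  qed
qed

lemma node_sum_square: "(node_sum i j k)\<^sup>2 = (1 + X k) * (1 + X j)"
  and node_diff_square: "(node_diff i j k)\<^sup>2 = (1 - X k) * (1 - X j)"
  by (rule cub_node_angles[of i j k];
      simp add: node_sum_def node_diff_def square_sum_cos square_diff_cos)+

lemma sym_ext_cub_node:
  "sym_ext p q (cub_node \<theta> i j k) = poly p (X k) * poly q (X j) + poly q (X k) * poly p (X j)"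
  by (rule cub_node_angles[of i j k]) (simp add: sym_ext_cos)

lemma node_signs:
  "node_sum 2 j k = node_sum 1 j k" "node_sum 3 j k = - node_sum 1 j k" "node_sum 4 j k = - node_sum 1 j k"
  "node_diff 2 j k = - node_diff 1 j k" "node_diff 3 j k = - node_diff 1 j k" "node_diff 4 j k = node_diff 1 j k"
  by (simp_all add: node_sum_def node_diff_def cub_node_def Let_def)

lemma sign_index_cases:
  assumes "i \<in> {1..4::nat}"
  obtains "i = 1" | "i = 2" | "i = 3" | "i = 4"
  using assms by fastforce

lemma node_pos:
  assumes "j \<in> {1..n}" "k \<in> {1..n}"
  shows "node_sum 1 j k > 0" "node_diff 1 j k > 0"
proof -
  define a b where "a = \<theta> j / 2" and "b = \<theta> k / 2"
  have ab: "0 < a" "a < pi / 2" "0 < b" "b < pi / 2" using \<theta> assms by (auto simp: a_def b_def)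
  have e: "(\<theta> j - \<theta> k) / 2 = a - b" "(\<theta> j + \<theta> k) / 2 = a + b" by (simp_all add: a_def b_def field_simps)
  have "node_sum 1 j k = 2 * (cos a * cos b)" "node_diff 1 j k = 2 * (sin a * sin b)"
    unfolding node_sum_def node_diff_def cub_node_def e Let_def by (simp_all add: cos_diff cos_add)
  then show "node_sum 1 j k > 0" "node_diff 1 j k > 0"
    using ab by (auto intro!: mult_pos_pos cos_gt_zero sin_gt_zero2)
qed

lemma node_nonzero:
  assumes "j \<in> {1..n}" "k \<in> {1..n}" "i \<in> {1..4}"
  shows "node_sum i j k \<noteq> 0" "node_diff i j k \<noteq> 0"
proof -
  have "node_sum i j k \<noteq> 0 \<and> node_diff i j k \<noteq> 0"
    by (rule sign_index_cases[OF assms(3)]; insert node_pos[OF assms(1,2)]; simp add: node_signs del: One_nat_def)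
  then show "node_sum i j k \<noteq> 0" "node_diff i j k \<noteq> 0" by auto
qed

text \<open>The four summands of the kernel belong to four weights, obtained from the original one by the
factors \<open>1\<close>, \<open>1 + x\<close>, \<open>1 - x\<close> and \<open>1 - x\<^sup>2\<close>. In each of them the kernels at the nodes, the fourth after its
corrections, are multiples of the same Lagrange basis polynomials. Together with the values of the linear forms the four summands
become \<open>1\<close>, \<open>s/S\<close>, \<open>d/T\<close> and \<open>s d/(S T)\<close> times one symmetric function, and the sum factors.\<close>

lemma K_star_cub_node:
  assumes j: "j \<in> {1..n}" and k: "k \<in> {1..n}" and i: "i \<in> {1..4}"
  shows "w j * w k * K_star \<alpha> \<beta> n x (cub_node \<theta> i j k) =
    1/2 * sym_ext (L k) (L j) x * (1 + (fst x + snd x) / node_sum i j k) * (1 + (fst x - snd x) / node_diff i j k)"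
proof -
  obtain \<phi>1 \<phi>2 where y: "cub_node \<theta> i j k = (cos \<phi>1, cos \<phi>2)"
    and u: "cos (\<phi>1 - \<phi>2) = X k" and v: "cos (\<phi>1 + \<phi>2) = X j"
    by (rule cub_node_angles)
  define S T s d where "S = node_sum i j k" and "T = node_diff i j k"
    and "s = fst x + snd x" and "d = fst x - snd x"
  have ST: "cos \<phi>1 + cos \<phi>2 = S" "cos \<phi>1 - cos \<phi>2 = T"
    by (simp_all add: S_def T_def node_sum_def node_diff_def y)
  have sq: "S\<^sup>2 = (1 + X k) * (1 + X j)" "T\<^sup>2 = (1 - X k) * (1 - X j)"
    unfolding S_def T_def by (rule node_sum_square node_diff_square)+
  have nz: "S \<noteq> 0" "T \<noteq> 0" using node_nonzero[OF j k i] by (simp_all add: S_def T_def)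
  have ab: "\<alpha> + 1 > -1" "\<beta> + 1 > -1" using \<alpha> \<beta> by auto
  let ?p = "jacobi_p (\<alpha> + 1) (\<beta> + 1) (n - 1)"
  define A where "A = sym_ext (kernel_poly \<alpha> \<beta> n (X k)) (kernel_poly \<alpha> \<beta> n (X j)) x"
  define B where "B = sym_ext (kernel_poly \<alpha> (\<beta> + 1) n (X k)) (kernel_poly \<alpha> (\<beta> + 1) n (X j)) x"
  define C where "C = sym_ext (kernel_poly (\<alpha> + 1) \<beta> n (X k)) (kernel_poly (\<alpha> + 1) \<beta> n (X j)) x"
  let ?D = "kernel_poly (\<alpha> + 1) (\<beta> + 1) (n - 1)"
  define D where "D = sym_ext (?D (X k)) (?D (X j)) x"
  define E where "E = sym_ext (?D (X k)) ?p x"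
  define F where "F = sym_ext ?p (?D (X j)) x"
  define G where "G = sym_ext ?p ?p x"
  define pk pj where "pk = poly ?p (X k)" and "pj = poly ?p (X j)"
  define r where "r = (1 + \<alpha> + \<beta> + real n) / (1 + \<alpha> + \<beta> + 2 * real n)"
  have den: "1 + \<alpha> + \<beta> + 2 * real n > 0" using \<alpha> \<beta> n by simp
  \<comment> \<open>The damping factor of the top term is \<open>r\<close>. Tensoring damps the doubly top term by \<open>r\<^sup>2\<close> and not by \<open>r\<close>,
and the term with \<open>Q2\<close> corrects the difference \<open>r - r\<^sup>2\<close>.\<close>
  have r': "real n * (1 + \<alpha> + \<beta> + real n) / (1 + \<alpha> + \<beta> + 2 * real n)\<^sup>2 = r * (1 - r)"
    using den by (simp add: r_def field_simps power2_eq_square)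
  have c: "jacobi_c \<alpha> \<beta> \<noteq> 0" using jacobi_c_pos[OF \<alpha> \<beta>] by simp
  have K: "K_prod \<alpha> \<beta> (int n - 1) x (cos \<phi>1, cos \<phi>2) = 1/2 * A"
    "K_prod \<alpha> (\<beta> + 1) (int n - 1) x (cos \<phi>1, cos \<phi>2) = 1/2 * B"
    "K_prod (\<alpha> + 1) \<beta> (int n - 1) x (cos \<phi>1, cos \<phi>2) = 1/2 * C"
    unfolding K_prod_eq_sym_ext_kernel_poly u v A_def B_def C_def by simp_all
  have int_n: "int n - 2 = int (n - 1) - 1" using n by simp
  have KD2: "K_prod (\<alpha> + 1) (\<beta> + 1) (int n - 2) x (cos \<phi>1, cos \<phi>2) = 1/2 * D"
    unfolding int_n K_prod_eq_sym_ext_kernel_poly u v D_def by simp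
  have ker: "kernel_poly (\<alpha> + 1) (\<beta> + 1) n y = ?D y + smult (poly ?p y) ?p" for y
    using kernel_poly_Suc[of "\<alpha> + 1" "\<beta> + 1" "n - 1"] n by simp
  have KD1: "K_prod (\<alpha> + 1) (\<beta> + 1) (int n - 1) x (cos \<phi>1, cos \<phi>2) = 1/2 * (D + pj * E + pk * F + pk * pj * G)"
    unfolding K_prod_eq_sym_ext_kernel_poly u v ker
    by (simp add: sym_ext_add sym_ext_add_right sym_ext_smult sym_ext_smult_right
        D_def E_def F_def G_def pk_def pj_def algebra_simps)
  have Q: "Q2 \<alpha> \<beta> n (n - 1) x * Q2 \<alpha> \<beta> n (n - 1) (cos \<phi>1, cos \<phi>2) =
      jacobi_d \<alpha> \<beta> 1 1 * (s * d) * (S * T) * (1/2 * (pk * pj * G))"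
  proof -
    have "sqrt 2 / 2 * Q_gamma \<alpha> \<beta> * (sqrt 2 / 2 * Q_gamma \<alpha> \<beta>) = 1/4 * jacobi_d \<alpha> \<beta> 1 1"
      by (simp add: Q_gamma_def jacobi_d_def power2_eq_square)
    moreover have "sym_ext ?p ?p (cos \<phi>1, cos \<phi>2) = 2 * (pk * pj)"
      by (simp add: sym_ext_cos u v pk_def pj_def)
    moreover have "(fst x)\<^sup>2 - (snd x)\<^sup>2 = s * d" "(cos \<phi>1)\<^sup>2 - (cos \<phi>2)\<^sup>2 = S * T"
      unfolding ST[symmetric] by (simp_all add: s_def d_def power2_eq_square algebra_simps)
    moreover have "h * (g * (s * d) * G) * (h * (g * (S * T) * (2 * (pk * pj)))) =
        h * g * (h * g) * (s * d) * (S * T) * (2 * (pk * pj * G))" for g h :: real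
      by (simp only: mult_ac)
    ultimately show ?thesis
      unfolding Q2_eq fst_conv snd_conv G_def[symmetric] by simp
  qed
  have K_star: "K_star \<alpha> \<beta> n x (cub_node \<theta> i j k) = 1/2 * (A
      + jacobi_d \<alpha> \<beta> 0 1 * s * S * B + jacobi_d \<alpha> \<beta> 1 0 * d * T * C
      + jacobi_d \<alpha> \<beta> 1 1 * (s * d) * (S * T) * (D + r * pj * E + r * pk * F + r * pk * (r * pj) * G))"
  proof -
    obtain x1 x2 where x: "x = (x1, x2)" by (cases x)
    have sd: "x1 + x2 = s" "x1 - x2 = d" by (simp_all add: s_def d_def x)
    have sd2: "x1\<^sup>2 - x2\<^sup>2 = s * d" "(cos \<phi>1)\<^sup>2 - (cos \<phi>2)\<^sup>2 = S * T"
      unfolding ST[symmetric] sd[symmetric] by (simp_all add: power2_eq_square algebra_simps)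
    have "K_star \<alpha> \<beta> n x (cos \<phi>1, cos \<phi>2) =
       1/2 * A + jacobi_d \<alpha> \<beta> 1 1 * (s * d) * (S * T) * (1/2 * D)
       + jacobi_d \<alpha> \<beta> 0 1 * s * S * (1/2 * B) + jacobi_d \<alpha> \<beta> 1 0 * d * T * (1/2 * C)
       + r * jacobi_d \<alpha> \<beta> 1 1 * (s * d) * (S * T) * (1/2 * (D + pj * E + pk * F + pk * pj * G) - 1/2 * D)
       - r * (1 - r) * (jacobi_d \<alpha> \<beta> 1 1 * (s * d) * (S * T) * (1/2 * (pk * pj * G)))"
      using K KD1 KD2 Q unfolding K_star_def K_odd_def x prod.case sd sd2 ST r_def[symmetric] r'
      by (simp only: mult.assoc)
    then show ?thesis unfolding y by algebra
  qed
  \<comment> \<open>The same function written with each of the four kernels.\<close>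
  have LA: "sym_ext (L k) (L j) x = w j * w k * A"
    by (simp add: L_kernel[OF k] L_kernel[OF j] sym_ext_smult sym_ext_smult_right A_def)
  have LB: "sym_ext (L k) (L j) x = w j * w k * (jacobi_d \<alpha> \<beta> 0 1 * S\<^sup>2 * B)"
  proof -
    have "L l = smult (jacobi_c \<alpha> (\<beta> + 1) / jacobi_c \<alpha> \<beta> * w l * (1 + X l)) (kernel_poly \<alpha> (\<beta> + 1) n (X l))"
      if "l \<in> {1..n}" for l
      using L_kernel_linear_modification[OF that \<alpha> ab(2), of "[:1, 1:]"] jacobi_int_Suc_right by simp
    from this[OF k] this[OF j] show ?thesis
      unfolding sq by (simp add: sym_ext_smult sym_ext_smult_right B_def jacobi_d_def power2_eq_square)
  qed
  have LC: "sym_ext (L k) (L j) x = w j * w k * (jacobi_d \<alpha> \<beta> 1 0 * T\<^sup>2 * C)"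
  proof -
    have "L l = smult (jacobi_c (\<alpha> + 1) \<beta> / jacobi_c \<alpha> \<beta> * w l * (1 - X l)) (kernel_poly (\<alpha> + 1) \<beta> n (X l))"
      if "l \<in> {1..n}" for l
      using L_kernel_linear_modification[OF that ab(1) \<beta>, of "[:1, -1:]"] jacobi_int_Suc_left by simp
    from this[OF k] this[OF j] show ?thesis
      unfolding sq by (simp add: sym_ext_smult sym_ext_smult_right C_def jacobi_d_def power2_eq_square)
  qed
  have LD: "sym_ext (L k) (L j) x = w j * w k * (jacobi_d \<alpha> \<beta> 1 1 * (S\<^sup>2 * T\<^sup>2) *
      (D + r * pj * E + r * pk * F + r * pk * (r * pj) * G))"
  proof -
    define Z where "Z = sym_ext (?D (X k) + smult (r * pk) ?p) (?D (X j) + smult (r * pj) ?p) x"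
    have Z: "Z = D + r * pj * E + r * pk * F + r * pk * (r * pj) * G"
      unfolding Z_def sym_ext_add sym_ext_add_right sym_ext_smult sym_ext_smult_right
        D_def[symmetric] E_def[symmetric] F_def[symmetric] G_def[symmetric] by algebra
    have "sym_ext (L k) (L j) x = (jacobi_c (\<alpha> + 1) (\<beta> + 1) / jacobi_c \<alpha> \<beta> * w k * (1 - (X k)\<^sup>2)) *
      ((jacobi_c (\<alpha> + 1) (\<beta> + 1) / jacobi_c \<alpha> \<beta> * w j * (1 - (X j)\<^sup>2)) * Z)"
      unfolding L_kernel_quadratic_modification[OF k] L_kernel_quadratic_modification[OF j]
        sym_ext_smult sym_ext_smult_right Z_def r_def pk_def pj_def by (rule mult.left_commute)
    also have "\<dots> = w j * w k * (jacobi_d \<alpha> \<beta> 1 1 * (S\<^sup>2 * T\<^sup>2) * Z)"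
      unfolding sq using c by (simp add: jacobi_d_def power2_eq_square field_simps)
    finally show ?thesis unfolding Z .
  qed
  define W where "W = sym_ext (L k) (L j) x"
  have "w j * w k * K_star \<alpha> \<beta> n x (cub_node \<theta> i j k) =
     1/2 * (w j * w k * A + s / S * (w j * w k * (jacobi_d \<alpha> \<beta> 0 1 * S\<^sup>2 * B))
        + d / T * (w j * w k * (jacobi_d \<alpha> \<beta> 1 0 * T\<^sup>2 * C))
        + s * d / (S * T) * (w j * w k * (jacobi_d \<alpha> \<beta> 1 1 * (S\<^sup>2 * T\<^sup>2) *
      (D + r * pj * E + r * pk * F + r * pk * (r * pj) * G))))"
  proof -
    have "s / S * (a * (c * S\<^sup>2 * b)) = a * (c * s * S * b)" "d / T * (a * (c * T\<^sup>2 * b)) = a * (c * d * T * b)"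
      "s * d / (S * T) * (a * (c * (S\<^sup>2 * T\<^sup>2) * b)) = a * (c * (s * d) * (S * T) * b)" for a b c
      using nz by (simp_all add: power2_eq_square)
    moreover have "a * (1/2 * (x1 + x2 + x3 + x4)) = 1/2 * (a * x1 + a * x2 + a * x3 + a * x4)"
      for a x1 x2 x3 x4 :: real by algebra
    ultimately show ?thesis unfolding K_star by (simp only:)
  qed
  also have "\<dots> = 1/2 * (W + s / S * W + d / T * W + s * d / (S * T) * W)"
    by (simp only: LA[symmetric, folded W_def] LB[symmetric, folded W_def] LC[symmetric, folded W_def] LD[symmetric, folded W_def])
  also have "\<dots> = 1/2 * W * (1 + s / S) * (1 + d / T)"
    unfolding times_divide_times_eq[symmetric] by algebra
  finally show ?thesis by (simp only: W_def s_def d_def S_def T_def)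
qed

lemma lagrange_ell_eq:
  assumes j: "j \<in> {1..n}" and k: "k \<in> {1..n}" and i: "i \<in> {1..4}"
  shows "lagrange_ell \<alpha> \<beta> n \<theta> i j k x = (if j = k then 1/8 else 1/4) *
    (sym_ext (L k) (L j) x * (1 + (fst x + snd x) / node_sum i j k) * (1 + (fst x - snd x) / node_diff i j k))"
  using K_star_cub_node[OF assms, of x]
  unfolding lagrange_ell_def w_eq_gauss_lambda(1)[OF j, symmetric] w_eq_gauss_lambda(1)[OF k, symmetric]
  by (cases "j = k") (simp_all add: mult.assoc)

lemma lagrange_ell_in_Pi_star:
  assumes j: "j \<in> {1..n}" and k: "k \<in> {1..n}" and i: "i \<in> {1..4}"
  shows "lagrange_ell \<alpha> \<beta> n \<theta> i j k \<in> Pi_star \<alpha> \<beta> n"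
proof -
  define c S T where "c = (if j = k then 1/8 else 1/4 :: real)" and "S = node_sum i j k" and "T = node_diff i j k"
  have deg: "degree (L k) < n" "degree (L j) < n" using degree_lagrange_basis[OF k] degree_lagrange_basis[OF j] .
  have "lagrange_ell \<alpha> \<beta> n \<theta> i j k = (\<lambda>x. c * (sym_ext (L k) (L j) x
     + (1 / S * ((fst x + snd x) * sym_ext (L k) (L j) x) + (1 / T * ((fst x - snd x) * sym_ext (L k) (L j) x)
     + 1 / (S * T) * ((fst x + snd x) * (fst x - snd x) * sym_ext (L k) (L j) x)))))"
    unfolding fun_eq_iff lagrange_ell_eq[OF assms] c_def[symmetric] S_def[symmetric] T_def[symmetric]
    by (simp add: divide_inverse) algebra
  also have "\<dots> \<in> Pi_star \<alpha> \<beta> n"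
    using deg by (intro Pi_star_mult_left Pi_star_add Pi_star_sym_ext Pi_star_sum_diff_sym_ext \<alpha> \<beta>)
  finally show ?thesis .
qed

text \<open>The symmetric part singles out the pair \<open>{j, k}\<close>, and the two sign factors single out one of its
four nodes. On the diagonal the symmetric part takes the value \<open>2\<close>, which the smaller coefficient
compensates.\<close>

lemma lagrange_ell_cub_node:
  assumes jk: "k \<in> {1..n}" "j \<in> {1..k}" "i \<in> {1..4}" and jk': "k' \<in> {1..n}" "j' \<in> {1..k'}" "i' \<in> {1..4}"
  shows "lagrange_ell \<alpha> \<beta> n \<theta> i j k (cub_node \<theta> i' j' k') = (if i = i' \<and> j = j' \<and> k = k' then 1 else 0)"
proof -
  have j: "j \<in> {1..n}" "j' \<in> {1..n}" using jk jk' by auto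
  have sym: "sym_ext (L k) (L j) (cub_node \<theta> i' j' k') = (if j = j' \<and> k = k' then if j = k then 2 else 1 else 0)"
    unfolding sym_ext_cub_node using poly_lagrange_basis[OF inj_X] j jk jk' by auto
  have eq: "lagrange_ell \<alpha> \<beta> n \<theta> i j k (cub_node \<theta> i' j' k') = (if j = k then 1/8 else 1/4) *
    (sym_ext (L k) (L j) (cub_node \<theta> i' j' k') * (1 + node_sum i' j' k' / node_sum i j k)
      * (1 + node_diff i' j' k' / node_diff i j k))"
    unfolding lagrange_ell_eq[OF j(1) jk(1,3)] node_sum_def node_diff_def ..
  show ?thesis
  proof (cases "j = j' \<and> k = k'")
    case True
    have "(1 + node_sum i' j k / node_sum i j k) * (1 + node_diff i' j k / node_diff i j k) = (if i = i' then 4 else 0)"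
      by (rule sign_index_cases[OF jk(3)]; rule sign_index_cases[OF jk'(3)];
          insert node_nonzero[OF j(1) jk(1), of 1]; simp add: node_signs del: One_nat_def)
    then show ?thesis unfolding eq sym using True by (simp add: mult.assoc)
  qed (auto simp: eq sym)
qed

definition reproduced :: "(real \<times> real \<Rightarrow> real) \<Rightarrow> bool" where
  "reproduced f \<longleftrightarrow> (\<forall>x. f x = (\<Sum>k=1..n. \<Sum>j=1..k. \<Sum>i=1..4.
     f (cub_node \<theta> i j k) * lagrange_ell \<alpha> \<beta> n \<theta> i j k x))"

lemma reproduced_zero: "reproduced (\<lambda>x. 0)"
  by (simp add: reproduced_def)

lemma reproduced_add: "reproduced f \<Longrightarrow> reproduced g \<Longrightarrow> reproduced (\<lambda>x. f x + g x)"
proof -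
  assume fg: "reproduced f" "reproduced g"
  have "f x + g x = (\<Sum>k=1..n. \<Sum>j=1..k. \<Sum>i=1..4.
     (f (cub_node \<theta> i j k) + g (cub_node \<theta> i j k)) * lagrange_ell \<alpha> \<beta> n \<theta> i j k x)" for x
    using arg_cong2[of _ _ _ _ "(+)", OF spec[OF fg(1)[unfolded reproduced_def], of x] spec[OF fg(2)[unfolded reproduced_def], of x]]
    by (simp only: distrib_right sum.distrib)
  then show ?thesis unfolding reproduced_def by blast
qed

lemma reproduced_mult_left: "reproduced f \<Longrightarrow> reproduced (\<lambda>x. c * f x)"
proof -
  assume f: "reproduced f"
  have "c * f x = (\<Sum>k=1..n. \<Sum>j=1..k. \<Sum>i=1..4.
     c * f (cub_node \<theta> i j k) * lagrange_ell \<alpha> \<beta> n \<theta> i j k x)" for x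
    using arg_cong[of _ _ "(*) c", OF spec[OF f[unfolded reproduced_def], of x]]
    by (simp only: sum_distrib_left mult.assoc)
  then show ?thesis unfolding reproduced_def by blast
qed

lemma reproduced_sum: "(\<And>i. i \<in> A \<Longrightarrow> reproduced (f i)) \<Longrightarrow> reproduced (\<lambda>x. \<Sum>i\<in>A. f i x)"
  by (induction A rule: infinite_finite_induct) (auto intro: reproduced_zero reproduced_add)

text \<open>Averaging over the signs of the two linear forms, with the sign factors of the basis, recovers the
monomial in \<open>x\<^sub>1 + x\<^sub>2\<close> and \<open>x\<^sub>1 - x\<^sub>2\<close>. What remains is univariate Lagrange interpolation in \<open>u\<close> and in
\<open>v\<close>.\<close>

lemma reproduced_generator:
  assumes "\<sigma> \<le> (1::nat)" "\<tau> \<le> (1::nat)" and p: "degree p < n" and q: "degree q < n"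
  shows "reproduced (\<lambda>x. (fst x + snd x) ^ \<sigma> * (fst x - snd x) ^ \<tau> * sym_ext p q x)"
  unfolding reproduced_def
proof
  fix x :: "real \<times> real"
  define s d where "s = fst x + snd x" and "d = fst x - snd x"
  define c where "c j k = poly p (X k) * poly q (X j) + poly q (X k) * poly p (X j)" for j k
  let ?f = "\<lambda>x. (fst x + snd x) ^ \<sigma> * (fst x - snd x) ^ \<tau> * sym_ext p q x"
  have f_node: "?f (cub_node \<theta> i j k) = node_sum i j k ^ \<sigma> * node_diff i j k ^ \<tau> * c j k" for i j k
    by (simp add: sym_ext_cub_node c_def node_sum_def node_diff_def)
  have signs: "(\<Sum>i=1..4. ?f (cub_node \<theta> i j k) * lagrange_ell \<alpha> \<beta> n \<theta> i j k x) =
      (if j = k then 1/2 else 1) * (s ^ \<sigma> * d ^ \<tau> * (c j k * sym_ext (L k) (L j) x))"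
    if k: "k \<in> {1..n}" and "j \<in> {1..k}" for j k
  proof -
    have j: "j \<in> {1..n}" using that by auto
    define S T where "S = node_sum 1 j k" and "T = node_diff 1 j k"
    have nz: "S \<noteq> 0" "T \<noteq> 0" using node_pos[OF j k] by (auto simp: S_def T_def)
    have node: "node_sum 1 j k = S" "node_sum 2 j k = S" "node_sum 3 j k = -S" "node_sum 4 j k = -S"
      "node_diff 1 j k = T" "node_diff 2 j k = -T" "node_diff 3 j k = -T" "node_diff 4 j k = T"
      by (simp_all add: S_def T_def node_signs del: One_nat_def)
    have four: "{1..4::nat} = {1, 2, 3, 4}" by auto
    define G where "G i = node_sum i j k ^ \<sigma> * node_diff i j k ^ \<tau> * (1 + s / node_sum i j k) * (1 + d / node_diff i j k)" for i
    have "G 1 + G 2 + G 3 + G 4 = 4 * (s ^ \<sigma> * d ^ \<tau>)"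
    proof -
      have "\<sigma> = 0 \<or> \<sigma> = 1" "\<tau> = 0 \<or> \<tau> = 1" using assms(1,2) by auto
      then show ?thesis
        unfolding G_def node using nz by (elim disjE) (simp_all add: field_simps)
    qed
    moreover have "?f (cub_node \<theta> i j k) * lagrange_ell \<alpha> \<beta> n \<theta> i j k x =
        (if j = k then 1/8 else 1/4) * (c j k * sym_ext (L k) (L j) x) * G i" if "i \<in> {1..4}" for i
      unfolding f_node lagrange_ell_eq[OF j k that] G_def s_def d_def by (simp only: mult_ac)
    then have "(\<Sum>i=1..4. ?f (cub_node \<theta> i j k) * lagrange_ell \<alpha> \<beta> n \<theta> i j k x) =
        (if j = k then 1/8 else 1/4) * (c j k * sym_ext (L k) (L j) x) * (\<Sum>i=1..4. G i)"
      unfolding sum_distrib_left by (intro sum.cong refl)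
    moreover have "(\<Sum>i=1..4. G i) = G 1 + G 2 + G 3 + G 4" unfolding four by simp
    ultimately show ?thesis by simp
  qed
  have tensor: "(\<Sum>k=1..n. \<Sum>j=1..n. c j k * sym_ext (L k) (L j) x) = 2 * sym_ext p q x"
  proof -
    have expand: "sym_ext f g x = (\<Sum>k=1..n. \<Sum>j=1..n. poly f (X k) * poly g (X j) * sym_ext (L k) (L j) x)"
      if "degree f < n" "degree g < n" for f g
    proof -
      have "sym_ext f g x = sym_ext (\<Sum>k=1..n. smult (poly f (X k)) (L k)) (\<Sum>j=1..n. smult (poly g (X j)) (L j)) x"
        using lagrange_interpolation[OF inj_X that(1)] lagrange_interpolation[OF inj_X that(2)] by metis
      then show ?thesis
        unfolding sym_ext_sum sym_ext_smult
        by (simp add: sym_ext_sum_right sym_ext_smult_right sum_distrib_left mult_ac)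
    qed
    show ?thesis
      using expand[OF p q] expand[OF q p] sym_ext_commute[of p q x]
      by (simp add: c_def distrib_right sum.distrib)
  qed
  have "(\<Sum>k=1..n. \<Sum>j=1..k. \<Sum>i=1..4. ?f (cub_node \<theta> i j k) * lagrange_ell \<alpha> \<beta> n \<theta> i j k x) =
      (\<Sum>k=1..n. \<Sum>j=1..k. (if j = k then 1/2 else 1) * (s ^ \<sigma> * d ^ \<tau> * (c j k * sym_ext (L k) (L j) x)))"
    by (intro sum.cong refl signs)
  also have "\<dots> = 1/2 * (\<Sum>k=1..n. \<Sum>j=1..n. s ^ \<sigma> * d ^ \<tau> * (c j k * sym_ext (L k) (L j) x))"
  proof (rule sum_triangle_symmetric)
    fix j k
    have "c j k = c k j" unfolding c_def by algebra
    then show "s ^ \<sigma> * d ^ \<tau> * (c j k * sym_ext (L k) (L j) x) = s ^ \<sigma> * d ^ \<tau> * (c k j * sym_ext (L j) (L k) x)"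
      using sym_ext_commute[of "L k" "L j" x] by (simp only:)
  qed
  also have "\<dots> = ?f x"
    unfolding sum_distrib_left[symmetric] tensor s_def d_def by simp
  finally show "?f x = (\<Sum>k=1..n. \<Sum>j=1..k. \<Sum>i=1..4. ?f (cub_node \<theta> i j k) * lagrange_ell \<alpha> \<beta> n \<theta> i j k x)" ..
qed

text \<open>In degree at most \<open>2n - 1\<close> the symmetric parts have degree below \<open>n\<close> in each of \<open>u\<close> and \<open>v\<close>.\<close>

lemma reproduced_sym_hull: "f \<in> sym_hull (2 * n - 1) \<Longrightarrow> reproduced f"
proof (induction rule: sym_hull.induct)
  case (gen \<sigma> \<tau> p d q c)
  then have "degree p < n" "degree q < n" using n by auto
  with gen show ?case by (intro reproduced_mult_left reproduced_generator)
qed (auto intro: reproduced_zero reproduced_add)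

lemma reproduced_Pi_star:
  assumes "f \<in> Pi_star \<alpha> \<beta> n"
  shows "reproduced f"
proof -
  obtain P b where P: "P \<in> Pi2 (2 * n - 1)" and f: "f = (\<lambda>x. P x + (\<Sum>k<n. b k * Q2 \<alpha> \<beta> n k x))"
    using assms unfolding Pi_star_def by blast
  have "reproduced (\<lambda>x. Q2 \<alpha> \<beta> n k x)" if "k < n" for k
  proof -
    have "\<alpha> + 1 > -1" "\<beta> + 1 > -1" using \<alpha> \<beta> by auto
    then have "reproduced (\<lambda>x. ((if k = n - 1 then sqrt 2 / 2 else 1) * Q_gamma \<alpha> \<beta>) *
      ((fst x + snd x) ^ 1 * (fst x - snd x) ^ 1 *
       sym_ext (jacobi_p (\<alpha> + 1) (\<beta> + 1) (n - 1)) (jacobi_p (\<alpha> + 1) (\<beta> + 1) k) x))"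
      using that n by (intro reproduced_mult_left reproduced_generator) auto
    also have "(\<lambda>x. ((if k = n - 1 then sqrt 2 / 2 else 1) * Q_gamma \<alpha> \<beta>) *
      ((fst x + snd x) ^ 1 * (fst x - snd x) ^ 1 *
       sym_ext (jacobi_p (\<alpha> + 1) (\<beta> + 1) (n - 1)) (jacobi_p (\<alpha> + 1) (\<beta> + 1) k) x)) = (\<lambda>x. Q2 \<alpha> \<beta> n k x)"
      unfolding Q2_eq power2_eq_square square_diff_square_factored power_one_right by (simp only: mult.assoc)
    finally show ?thesis .
  qed
  then show ?thesis
    unfolding f using reproduced_sym_hull[OF Pi2_subset_sym_hull[OF P]]
    by (intro reproduced_add reproduced_sum reproduced_mult_left) auto
qed

end

theorem theorem6p1:
  fixes \<alpha> \<beta> :: real and n :: nat and \<theta> :: "nat \<Rightarrow> real" and f :: "real \<times> real \<Rightarrow> real"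
  assumes "\<alpha> > -1" and "\<beta> > -1" and "n \<ge> 1"
    and "\<And>k. k \<in> {1..n} \<Longrightarrow> 0 < \<theta> k \<and> \<theta> k < pi"
    and "bij_betw (\<lambda>k. cos (\<theta> k)) {1..n} {x. poly (jacobi_P \<alpha> \<beta> n) x = 0}"
  shows "(\<exists>!L. L \<in> Pi_star \<alpha> \<beta> n \<and> interpolates n \<theta> f L) \<and>
         (\<forall>x y. lagrange_interp \<alpha> \<beta> n \<theta> f (x, y) =
            (\<Sum>k=1..n. \<Sum>j=1..k. \<Sum>i=1..4.
               f (cub_node \<theta> i j k) * lagrange_ell \<alpha> \<beta> n \<theta> i j k (x, y)))"
proof -
  interpret jacobi_nodes \<alpha> \<beta> n \<theta>
    using assms by unfold_locales
  define R where "R = (\<lambda>x. \<Sum>k=1..n. \<Sum>j=1..k. \<Sum>i=1..4. f (cub_node \<theta> i j k) * lagrange_ell \<alpha> \<beta> n \<theta> i j k x)"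
  have R_in: "R \<in> Pi_star \<alpha> \<beta> n"
    unfolding R_def by (intro Pi_star_sum Pi_star_mult_left lagrange_ell_in_Pi_star) auto
  have R_interpolates: "interpolates n \<theta> f R"
    unfolding interpolates_def
  proof (intro ballI)
    fix k j i assume *: "k \<in> {1..n}" "j \<in> {1..k}" "i \<in> {1..4::nat}"
    have "R (cub_node \<theta> i j k) = (\<Sum>k'=1..n. \<Sum>j'=1..k'. \<Sum>i'=1..4.
        if i' = i then if j' = j then if k' = k then f (cub_node \<theta> i j k) else 0 else 0 else 0)"
      unfolding R_def
    proof (intro sum.cong refl)
      fix k' j' i' assume "k' \<in> {1..n}" "j' \<in> {1..k'}" "i' \<in> {1..4::nat}"
      from lagrange_ell_cub_node[OF this *]
      show "f (cub_node \<theta> i' j' k') * lagrange_ell \<alpha> \<beta> n \<theta> i' j' k' (cub_node \<theta> i j k) =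
          (if i' = i then if j' = j then if k' = k then f (cub_node \<theta> i j k) else 0 else 0 else 0)"
        by auto
    qed
    also have "\<dots> = (\<Sum>k'=1..n. \<Sum>j'=1..k'. if j' = j then if k' = k then f (cub_node \<theta> i j k) else 0 else 0)"
      using * by (intro sum.cong refl) (subst sum.delta, auto)
    also have "\<dots> = (\<Sum>k'=1..n. if k' = k then f (cub_node \<theta> i j k) else 0)"
      using * by (intro sum.cong refl) (subst sum.delta, auto)
    also have "\<dots> = f (cub_node \<theta> i j k)" using * by simp
    finally show "R (cub_node \<theta> i j k) = f (cub_node \<theta> i j k)" .
  qed
  have unique: "P = R" if P: "P \<in> Pi_star \<alpha> \<beta> n" "interpolates n \<theta> f P" for P
  proof
    fix x
    have "P x = (\<Sum>k=1..n. \<Sum>j=1..k. \<Sum>i=1..4. P (cub_node \<theta> i j k) * lagrange_ell \<alpha> \<beta> n \<theta> i j k x)"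
      using reproduced_Pi_star[OF P(1)] unfolding reproduced_def by blast
    also have "\<dots> = R x"
      unfolding R_def using P(2) unfolding interpolates_def by (intro sum.cong refl arg_cong2[of _ _ _ _ times]) auto
    finally show "P x = R x" .
  qed
  have ex1: "\<exists>!L. L \<in> Pi_star \<alpha> \<beta> n \<and> interpolates n \<theta> f L"
    using R_in R_interpolates unique by blast
  then have "lagrange_interp \<alpha> \<beta> n \<theta> f = R"
    unfolding lagrange_interp_def using R_in R_interpolates by (intro the1_equality) auto
  then show ?thesis using ex1 by (simp add: R_def)
qed

end
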